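(* Suppose $\mathfrak{C}\supseteq\mathfrak{C}_{Het}$ and $(X,R)$ satisfies the rank condition. Let $0<C<\infty$ and $W_{Het}(C)=\{y\in\mathbb{R}^n:T_{Het}(y)\ge C\}$. Then: 1. Suppose for some $i$, $1\le i\le n$, we have $\operatorname{rank}(B(e_i(n)))=q$ and $T_{Het}(e_i(n)+\mu_0^* )>C$ for some (and hence all) $\mu_0^*\in\mathfrak{M}_0$. Then $\sup_{\Sigma\in\mathfrak{C}}P_{\mu_0,\sigma^2\Sigma}(W_{Het}(C))=1$ for every $\mu_0\in\mathfrak{M}_0$ and every $0<\sigma^2<\infty$. In particular, the size of the test equals one. 2. Suppose for some $i$, $1\le i\le n$, we have $\operatorname{rank}(B(e_i(n)))=q$ and $T_{Het}(e_i(n)+\mu_0^* )<C$ for some (and hence all) $\mu_0^*\in\mathfrak{M}_0$. Then $\inf_{\Sigma\in\mathfrak{C}}P_{\mu_0,\sigma^2\Sigma}(W_{Het}(C))=0$ for every $\mu_0\in\mathfrak{M}_0$ and every $0<\sigma^2<\infty$, and hence $\inf_{\mu_1\in\mathfrak{M}_1}\inf_{\Sigma\in\mathfrak{C}}P_{\mu_1,\sigma^2\Sigma}(W_{Het}(C))=0$ for every $0<\sigma^2<\infty$. In particular, the test is biased. Furthermore, for every $\mu_1\in\mathfrak{M}_1$, $\inf_{0<\sigma^2<\infty}\inf_{\Sigma\in\mathfrak{C}}P_{\mu_1,\sigma^2\Sigma}(W_{Het}(C))=0$. In particular, the infimal power of the test equals zero. 3. Suppose for some $i$, $1\le i\le n$,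 we have $B(e_i(n))=0$ and $R\hat\beta(e_i(n))\ne0$. Then $\sup_{\Sigma\in\mathfrak{C}}P_{\mu_0,\sigma^2\Sigma}(W_{Het}(C))=1$ for every $\mu_0\in\mathfrak{M}_0$ and every $0<\sigma^2<\infty$. In particular, the size of the test equals one.
   Context: Framework: $n,k,q$ are integers with $1\le k<n$, $q\ge1$; $X$ is a fixed real $n\times k$ matrix of rank $k$; $R$ is a fixed real $q\times k$ matrix of rank $q$; $r\in\mathbb{R}^q$. $\mathfrak{C}$ (covariance model) is a nonempty set of symmetric positive definite $n\times n$ matrices such that $\sigma^2\in(0,\infty)$ and $\Sigma\in\mathfrak{C}$ are uniquely determined by $\sigma^2\Sigma$. $\mathfrak{M}=\operatorname{span}(X)$, $\mathfrak{M}_0=\{X\beta:\beta\in\mathbb{R}^k,\ R\beta=r\}$, $\mathfrak{M}_1=\mathfrak{M}\setminus\mathfrak{M}_0$. $P_{\mu,\Phi}$ is the Gaussian measure on $\mathbb{R}^n$ with mean $\mu$ and covariance matrix $\Phi$. The testing problem is $H_0:\mu\in\mathfrak{M}_0$ versus $H_1:\mu\in\mathfrak{M}_1$ (in both cases $0<\sigma^2<\infty$, $\Sigma\in\mathfrak{C}$ arbitrary), observation $\sim P_{\mu,\sigma^2\Sigma}$. For a rejection region $W$, size is the supremum of $P_{\mu,\sigma^2\Sigma}(W)$ over $H_0$, infimal power the infimum over $H_1$; the test is biased if the infimal power is strictly smaller than the size. $\hat\beta(y)=(X'X)^{-1}X'y$, $\hat u(y)=y-X\hat\beta(y)$ with coordinates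 $\hat u_t(y)$; $e_i(n)$ is the $i$-th standard basis vector of $\mathbb{R}^n$. $\mathfrak{C}_{Het}=\{\operatorname{diag}(\tau_1^2,\dots,\tau_n^2):\tau_i^2>0,\ i=1,\dots,n,\ \sum_{i=1}^n\tau_i^2=1\}$. Test statistic: for given constants $d_i>0$ ($i=1,\dots,n$), which may depend on $X$, $\hat\Psi_{Het}(y)=(X'X)^{-1}X'\operatorname{diag}(d_1\hat u_1^2(y),\dots,d_n\hat u_n^2(y))X(X'X)^{-1}$, $\hat\Omega_{Het}(y)=R\hat\Psi_{Het}(y)R'$, and $T_{Het}(y)=(R\hat\beta(y)-r)'\hat\Omega_{Het}^{-1}(y)(R\hat\beta(y)-r)$ if $\det\hat\Omega_{Het}(y)\ne0$, $T_{Het}(y)=0$ otherwise. $B(y)=R(X'X)^{-1}X'\operatorname{diag}(\hat u_1(y),\dots,\hat u_n(y))$. Rank condition on $(X,R)$: let $i_1<\dots<i_s$ be all indices $i$ with $e_i(n)\in\operatorname{span}(X)$ ($s=0$ if there are none) and let $X'(\neg(i_1,\dots,i_s))$ be $X'$ with the columns with these indices deleted; then $\operatorname{rank}(R(X'X)^{-1}X'(\neg(i_1,\dots,i_s)))=q$. *)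

theory Defs
  imports "HOL-Probability.Probability"
begin

section \<open>Linear regression quantities\<close>

definition diag :: "real ^ 'n \<Rightarrow> real ^ 'n ^ 'n" where
  "diag v = (\<chi> i j. if i = j then v $ i else 0)"

definition beta_hat :: "real ^ 'k ^ 'n \<Rightarrow> real ^ 'n \<Rightarrow> real ^ 'k" where
  "beta_hat X y = (matrix_inv (transpose X ** X) ** transpose X) *v y"

definition u_hat :: "real ^ 'k ^ 'n \<Rightarrow> real ^ 'n \<Rightarrow> real ^ 'n" where
  "u_hat X y = y - X *v beta_hat X y"

definition \<MM>\<^sub>0 :: "real ^ 'k ^ 'n \<Rightarrow> real ^ 'k ^ 'q \<Rightarrow> real ^ 'q \<Rightarrow> (real ^ 'n) set" where
  "\<MM>\<^sub>0 X R r = {X *v \<beta> | \<beta>. R *v \<beta> = r}"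

definition \<MM>\<^sub>1 :: "real ^ 'k ^ 'n \<Rightarrow> real ^ 'k ^ 'q \<Rightarrow> real ^ 'q \<Rightarrow> (real ^ 'n) set" where
  "\<MM>\<^sub>1 X R r = span (columns X) - \<MM>\<^sub>0 X R r"


section \<open>Covariance models and Gaussian measures\<close>

definition sym_pos_def :: "real ^ 'n ^ 'n \<Rightarrow> bool" where
  "sym_pos_def A \<longleftrightarrow> transpose A = A \<and> (\<forall>x. x \<noteq> 0 \<longrightarrow> x \<bullet> (A *v x) > 0)"

definition covariance_model :: "(real ^ 'n ^ 'n) set \<Rightarrow> bool" where
  "covariance_model \<CC> \<longleftrightarrow>
     \<CC> \<noteq> {} \<and> (\<forall>\<Sigma>\<in>\<CC>. sym_pos_def \<Sigma>) \<and>
     inj_on (\<lambda>(\<sigma>2 :: real, \<Sigma>). \<sigma>2 *\<^sub>R \<Sigma>) ({0<..} \<times> \<CC>)"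

definition \<CC>_Het :: "(real ^ 'n ^ 'n) set" where
  "\<CC>_Het = {diag (\<chi> i. (\<tau> $ i)\<^sup>2) | \<tau> :: real ^ 'n.
              (\<forall>i. (\<tau> $ i)\<^sup>2 > 0) \<and> (\<Sum>i\<in>UNIV. (\<tau> $ i)\<^sup>2) = 1}"

text \<open>The Gaussian measure with mean \<open>\<mu>\<close> and covariance matrix \<open>\<Phi>\<close>, given by its Lebesgue
  density. This is meaningful only for symmetric positive definite \<open>\<Phi>\<close>.\<close>

definition gaussian :: "real ^ 'n \<Rightarrow> real ^ 'n ^ 'n \<Rightarrow> (real ^ 'n) measure" where
  "gaussian \<mu> \<Phi> = density lborel (\<lambda>y. ennreal
     (exp (- ((y - \<mu>) \<bullet> (matrix_inv \<Phi> *v (y - \<mu>))) / 2) / sqrt ((2 * pi) ^ CARD('n) * det \<Phi>)))"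


section \<open>Size, power and bias of a rejection region\<close>

definition size_of_test ::
  "real ^ 'k ^ 'n \<Rightarrow> real ^ 'k ^ 'q \<Rightarrow> real ^ 'q \<Rightarrow> (real ^ 'n ^ 'n) set \<Rightarrow> (real ^ 'n) set \<Rightarrow> real" where
  "size_of_test X R r \<CC> W =
     (SUP (\<mu>, \<sigma>2, \<Sigma>) \<in> \<MM>\<^sub>0 X R r \<times> {0<..} \<times> \<CC>. measure (gaussian \<mu> (\<sigma>2 *\<^sub>R \<Sigma>)) W)"

definition infimal_power ::
  "real ^ 'k ^ 'n \<Rightarrow> real ^ 'k ^ 'q \<Rightarrow> real ^ 'q \<Rightarrow> (real ^ 'n ^ 'n) set \<Rightarrow> (real ^ 'n) set \<Rightarrow> real" where
  "infimal_power X R r \<CC> W =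
     (INF (\<mu>, \<sigma>2, \<Sigma>) \<in> \<MM>\<^sub>1 X R r \<times> {0<..} \<times> \<CC>. measure (gaussian \<mu> (\<sigma>2 *\<^sub>R \<Sigma>)) W)"

definition biased_test ::
  "real ^ 'k ^ 'n \<Rightarrow> real ^ 'k ^ 'q \<Rightarrow> real ^ 'q \<Rightarrow> (real ^ 'n ^ 'n) set \<Rightarrow> (real ^ 'n) set \<Rightarrow> bool" where
  "biased_test X R r \<CC> W \<longleftrightarrow> infimal_power X R r \<CC> W < size_of_test X R r \<CC> W"


section \<open>The heteroskedasticity robust test\<close>

definition Psi_Het :: "real ^ 'k ^ 'n \<Rightarrow> real ^ 'n \<Rightarrow> real ^ 'n \<Rightarrow> real ^ 'k ^ 'k" where
  "Psi_Het X d y =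
     matrix_inv (transpose X ** X) ** transpose X ** diag (\<chi> i. d $ i * (u_hat X y $ i)\<^sup>2)
       ** X ** matrix_inv (transpose X ** X)"

definition Omega_Het ::
  "real ^ 'k ^ 'n \<Rightarrow> real ^ 'k ^ 'q \<Rightarrow> real ^ 'n \<Rightarrow> real ^ 'n \<Rightarrow> real ^ 'q ^ 'q" where
  "Omega_Het X R d y = R ** Psi_Het X d y ** transpose R"

definition T_Het ::
  "real ^ 'k ^ 'n \<Rightarrow> real ^ 'k ^ 'q \<Rightarrow> real ^ 'q \<Rightarrow> real ^ 'n \<Rightarrow> real ^ 'n \<Rightarrow> real" where
  "T_Het X R r d y =
     (if det (Omega_Het X R d y) \<noteq> 0
      then (R *v beta_hat X y - r) \<bullet> (matrix_inv (Omega_Het X R d y) *v (R *v beta_hat X y - r))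
      else 0)"

definition W_Het ::
  "real ^ 'k ^ 'n \<Rightarrow> real ^ 'k ^ 'q \<Rightarrow> real ^ 'q \<Rightarrow> real ^ 'n \<Rightarrow> real \<Rightarrow> (real ^ 'n) set" where
  "W_Het X R r d C = {y. T_Het X R r d y \<ge> C}"

definition B_Het :: "real ^ 'k ^ 'n \<Rightarrow> real ^ 'k ^ 'q \<Rightarrow> real ^ 'n \<Rightarrow> real ^ 'n ^ 'q" where
  "B_Het X R y = R ** matrix_inv (transpose X ** X) ** transpose X ** diag (u_hat X y)"

text \<open>Deleting columns changes the dimension of a matrix, which here is part of its type. The rank of
  the matrix \<open>R (X'X)\<^sup>-\<^sup>1 X'(\<not>(i\<^sub>1, \<dots>, i\<^sub>s))\<close> is therefore written out as the dimension of the space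
  spanned by its columns (cf. \<open>column_rank_def\<close>), i.e. by those columns of \<open>R (X'X)\<^sup>-\<^sup>1 X'\<close> whose
  index \<open>i\<close> is not deleted.\<close>

definition rank_condition :: "real ^ 'k ^ 'n \<Rightarrow> real ^ 'k ^ 'q \<Rightarrow> bool" where
  "rank_condition X R \<longleftrightarrow>
     dim {column i (R ** matrix_inv (transpose X ** X) ** transpose X) | i.
            axis i 1 \<notin> span (columns X)} = CARD('q)"

end

theory Submission imports Defs
begin

text \<open>
The test statistic is invariant under \<open>y \<mapsto> \<mu>\<^sub>0 + c (y - \<mu>\<^sub>0)\<close> for \<open>\<mu>\<^sub>0 \<in> \<MM>\<^sub>0\<close> and \<open>c \<noteq> 0\<close>
(\<open>T_Het_shift\<close>, \<open>T_Het_scale\<close>). A heteroskedastic covariance model contains covariance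
matrices that come arbitrarily close to the degenerate matrix with a single entry one at position
\<open>(i, i)\<close>. Along such a sequence the centred observation, written as the image of one fixed standard
Gaussian vector \<open>z\<close>, tends to \<open>z\<^sub>i e\<^sub>i\<close>, a nonzero multiple of \<open>e\<^sub>i\<close> for almost every \<open>z\<close>. The value of
the statistic near \<open>e\<^sub>i\<close> alone therefore decides the limit of the rejection probability.

If \<open>B(e\<^sub>i)\<close> has full rank, the covariance estimator is regular at \<open>e\<^sub>i\<close>, the statistic is continuous
there, and by dominated convergence the rejection probability tends to one or to zero according to
whether the value at \<open>e\<^sub>i\<close> lies above or below \<open>C\<close> (\<open>rejection_prob_tendsto_1\<close>,
\<open>rejection_prob_tendsto_0\<close>). If \<open>B(e\<^sub>i) = 0\<close> and \<open>R \<beta>(e\<^sub>i) \<noteq> 0\<close>, the statistic has the form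
\<open>v \<bullet> \<Omega>\<^sup>-\<^sup>1 v\<close> with \<open>\<Omega>\<close> tending to zero and \<open>v\<close> tending to a nonzero limit, so it tends to infinity;
the rank condition makes \<open>\<Omega>\<close> regular outside a null set, where alone this form is valid
(\<open>rejection_prob_tendsto_1_degenerate\<close>).

Under the alternative the same limit applies as long as the distance of the mean from \<open>\<MM>\<^sub>0\<close>, divided by
the standard deviation, tends to zero. This holds if the mean approaches \<open>\<MM>\<^sub>0\<close> and also if the variance
grows without bound (\<open>rejection_INF_eq_0\<close>). Bias then only requires a positive size
(\<open>size_of_test_pos\<close>).

The upper bound one for the rejection probabilities, needed for the suprema over an arbitrary
covariance model, rests on the normalisation of general Gaussian densities
(\<open>prob_space_gaussian\<close>). It follows from the transformation rule of Lebesgue measure under linear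
maps and from a factorisation \<open>\<Phi> = L L'\<close> of the covariance matrix.
\<close>

section \<open>Matrices and their inverses\<close>

lemma matrix_inv_left_right:
  fixes A :: "real^'n^'n"
  assumes "invertible A"
  shows "A ** matrix_inv A = mat 1" and "matrix_inv A ** A = mat 1"
proof -
  have "A ** matrix_inv A = mat 1 \<and> matrix_inv A ** A = mat 1"
    using assms unfolding matrix_inv_def invertible_def by (rule someI_ex)
  then show "A ** matrix_inv A = mat 1" and "matrix_inv A ** A = mat 1" by auto
qed

lemma matrix_inv_unique:
  fixes A B :: "real^'n^'n"
  assumes "A ** B = mat 1"
  shows "matrix_inv A = B"
proof -
  have "invertible A"
    using assms invertible_right_inverse by blast
  then have "matrix_inv A ** (A ** B) = B"
    by (simp add: matrix_mul_assoc matrix_inv_left_right)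
  then show ?thesis using assms by simp
qed

lemma invertible_of_pos_def:
  fixes A :: "real^'n^'n"
  assumes "\<And>x. x \<noteq> 0 \<Longrightarrow> x \<bullet> (A *v x) > 0"
  shows "invertible A"
proof -
  have "\<forall>x. A *v x = 0 \<longrightarrow> x = 0"
    using assms by (metis inner_zero_right less_irrefl)
  then show ?thesis
    using matrix_left_invertible_ker invertible_left_inverse by blast
qed

lemma det_nz_iff_kernel:
  fixes A :: "real^'n^'n"
  shows "det A \<noteq> 0 \<longleftrightarrow> (\<forall>x. A *v x = 0 \<longrightarrow> x = 0)"
  by (simp add: invertible_det_nz[symmetric] invertible_left_inverse matrix_left_invertible_ker)

lemma matrix_inv_solves:
  fixes A :: "real^'n^'n"
  assumes "det A \<noteq> 0"
  shows "A *v (matrix_inv A *v b) = b" and "matrix_inv A *v (A *v b) = b"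
  using assms by (simp_all add: matrix_vector_mul_assoc matrix_inv_left_right invertible_det_nz)

lemma diag_mult_vec: "diag v *v x = (\<chi> i. v $ i * x $ i)"
  by (simp add: diag_def matrix_vector_mult_def vec_eq_iff if_distribR if_distrib[of "\<lambda>c. c * _"] cong: if_cong)

lemma inner_matrix_transpose:
  fixes A :: "real^'m^'n"
  shows "x \<bullet> (A *v y) = (transpose A *v x) \<bullet> y"
  by (simp add: transpose_matrix_vector dot_lmul_matrix)

lemma transpose_matrix_inv:
  fixes A :: "real^'n^'n"
  assumes "invertible A"
  shows "transpose (matrix_inv A) = matrix_inv (transpose A)"
proof (rule matrix_inv_unique[symmetric])
  have "transpose A ** transpose (matrix_inv A) = transpose (matrix_inv A ** A)"
    by (simp only: matrix_transpose_mul)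
  then show "transpose A ** transpose (matrix_inv A) = mat 1"
    by (simp add: matrix_inv_left_right[OF assms])
qed

lemma tendsto_det:
  fixes A :: "'a \<Rightarrow> real^'n^'n"
  assumes "(A \<longlongrightarrow> B) F"
  shows "((\<lambda>m. det (A m)) \<longlongrightarrow> det B) F"
  unfolding det_def
  by (intro tendsto_sum tendsto_mult tendsto_prod tendsto_const tendsto_vec_nth assms)

text \<open>Cramer's rule exhibits the solution of a regular linear system as a quotient of determinants, so it
depends continuously on the matrix and on the right-hand side.\<close>
lemma tendsto_matrix_inv_mult:
  fixes A :: "'a \<Rightarrow> real^'n^'n"
  assumes A: "(A \<longlongrightarrow> A0) F" and b: "(b \<longlongrightarrow> b0) F" and nz: "det A0 \<noteq> 0"
  shows "((\<lambda>m. matrix_inv (A m) *v b m) \<longlongrightarrow> matrix_inv A0 *v b0) F"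
proof -
  let ?s = "\<lambda>A b. \<chi> k. det (\<chi> i j. if j = k then b $ i else A $ i $ j) / det A :: real^'n"
  have s: "matrix_inv M *v c = ?s M c" if "det M \<noteq> 0" for M :: "real^'n^'n" and c
    using cramer[OF that] matrix_inv_solves(1)[OF that] by blast
  have "((\<lambda>m. ?s (A m) (b m)) \<longlongrightarrow> ?s A0 b0) F"
  proof (intro tendsto_vec_lambda tendsto_divide tendsto_det A nz)
    fix k i j
    show "((\<lambda>m. if j = k then b m $ i else A m $ i $ j) \<longlongrightarrow> (if j = k then b0 $ i else A0 $ i $ j)) F"
      using A b by (auto intro!: tendsto_vec_nth)
  qed
  moreover have "\<forall>\<^sub>F m in F. ?s (A m) (b m) = matrix_inv (A m) *v b m"
    using tendsto_imp_eventually_ne[OF tendsto_det[OF A] nz] by eventually_elim (simp add: s)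
  ultimately show ?thesis
    unfolding s[OF nz] by (rule Lim_transform_eventually)
qed

section \<open>Lebesgue measure under linear maps\<close>

text \<open>Lebesgue measure is a product measure: for fixed values of the other coordinates, the shear is a
translation of the coordinate \<open>m\<close>.\<close>
lemma nn_integral_lborel_shear:
  fixes g :: "real^'n \<Rightarrow> ennreal"
  assumes mn: "m \<noteq> n" and [measurable]: "g \<in> borel_measurable borel"
  shows "(\<integral>\<^sup>+x. g (x + (x $ n) *\<^sub>R axis m 1) \<partial>lborel) = (\<integral>\<^sup>+x. g x \<partial>lborel)"
proof -
  let ?B = "Basis :: (real^'n) set"
  let ?i = "axis m 1 :: real^'n" and ?j = "axis n 1 :: real^'n"
  define I where "I = ?B - {?i}"
  have iB: "?i \<in> ?B" "?j \<in> ?B" by (auto simp: axis_in_Basis_iff)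
  have ins: "insert ?i I = ?B" and iI: "?i \<notin> I" "finite I" using iB by (auto simp: I_def)
  have jI: "?j \<in> I" using iB mn by (auto simp: I_def axis_eq_axis)
  interpret product_sigma_finite "\<lambda>b::real^'n. interval_measure (\<lambda>x. x)"
    by (simp add: lborel_eq_real[symmetric] product_sigma_finite_def lborel.sigma_finite_measure_axioms)
  let ?v = "\<lambda>f. \<Sum>b\<in>?B. f b *\<^sub>R b"
  have sum_upd: "?v (x(?i := y)) = y *\<^sub>R ?i + (\<Sum>b\<in>I. x b *\<^sub>R b)" for x y
    unfolding ins[symmetric] using iI by (subst sum.insert) (auto intro!: sum.cong)
  have nth: "?v f $ n = f ?j" for f
  proof -
    have "?v f $ n = ?v f \<bullet> ?j" by (simp add: inner_axis)
    also have "\<dots> = f ?j" using iB by (rule_tac inner_sum_left_Basis) auto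
    finally show ?thesis .
  qed
  have *: "(\<integral>\<^sup>+x. h x \<partial>lborel) =
     (\<integral>\<^sup>+x. (\<integral>\<^sup>+y. h (?v (x(?i := y))) \<partial>lborel) \<partial>(Pi\<^sub>M I (\<lambda>_. interval_measure (\<lambda>x. x))))"
    if [measurable]: "h \<in> borel_measurable borel" for h :: "real^'n \<Rightarrow> ennreal"
  proof -
    have "(\<integral>\<^sup>+x. h x \<partial>lborel) = (\<integral>\<^sup>+f. h (?v f) \<partial>(Pi\<^sub>M (insert ?i I) (\<lambda>_. interval_measure (\<lambda>x. x))))"
      unfolding lborel_def ins by (subst nn_integral_distr) auto
    also have "\<dots> = (\<integral>\<^sup>+x. (\<integral>\<^sup>+y. h (?v (x(?i := y))) \<partial>(interval_measure (\<lambda>x. x))) \<partial>(Pi\<^sub>M I (\<lambda>_. interval_measure (\<lambda>x. x))))"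
      using iI by (subst product_nn_integral_insert) (auto simp: ins)
    finally show ?thesis by (simp add: lborel_eq_real)
  qed
  have "(\<integral>\<^sup>+y. g (?v (x(?i := y)) + (?v (x(?i := y)) $ n) *\<^sub>R ?i) \<partial>lborel) = (\<integral>\<^sup>+y. g (?v (x(?i := y))) \<partial>lborel)" for x
  proof -
    have "?i \<noteq> ?j" using mn by (simp add: axis_eq_axis)
    then have e: "?v (x(?i := y)) + (?v (x(?i := y)) $ n) *\<^sub>R ?i = ?v (x(?i := x ?j + 1 * y))" for y
      unfolding nth unfolding sum_upd by (simp add: algebra_simps)
    have "(\<integral>\<^sup>+y. g (?v (x(?i := y))) \<partial>lborel) = (\<integral>\<^sup>+y. g (?v (x(?i := x ?j + 1 * y))) \<partial>lborel)"
      unfolding sum_upd by (subst nn_integral_real_affine[where c=1 and t="x ?j"]) auto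
    then show ?thesis unfolding e by simp
  qed
  then show ?thesis by (subst (1 2) *) auto
qed

lemma prod_Basis_cart:
  fixes f :: "real^'n \<Rightarrow> 'b::comm_monoid_mult"
  shows "(\<Prod>b\<in>Basis. f b) = (\<Prod>i\<in>UNIV. f (axis i 1))"
proof -
  have "(Basis :: (real^'n) set) = range (\<lambda>i. axis i 1)"
    by (auto simp: Basis_vec_def)
  moreover have "inj (\<lambda>i::'n. axis i (1::real))"
    by (auto simp: inj_def axis_eq_axis)
  ultimately show ?thesis
    by (subst \<open>Basis = _\<close>, subst prod.reindex) (simp_all add: o_def)
qed

lemma nn_integral_lborel_permute:
  fixes g :: "real^'n \<Rightarrow> ennreal"
  assumes [measurable]: "g \<in> borel_measurable borel" and p: "p permutes UNIV"
  shows "(\<integral>\<^sup>+x. g (\<chi> i. x $ p i) \<partial>lborel) = (\<integral>\<^sup>+x. g x \<partial>lborel)"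
proof -
  let ?h = "\<lambda>x::real^'n. \<chi> i. x $ p i"
  have "linear ?h" by (rule linearI) (simp_all add: plus_vec_def scaleR_vec_def)
  then have [measurable]: "?h \<in> borel_measurable borel"
    by (intro borel_measurable_continuous_onI linear_continuous_on) (simp add: linear_conv_bounded_linear)
  have "lborel = distr lborel borel ?h"
  proof (rule lborel_eqI)
    fix l u :: "real^'n" assume le: "\<And>b. b \<in> Basis \<Longrightarrow> l \<bullet> b \<le> u \<bullet> b"
    have le': "l $ i \<le> u $ i" for i
      using le[of "axis i 1"] by (auto simp: inner_axis axis_in_Basis_iff)
    have pinv: "p (inv p i) = i" "inv p (p i) = i" for i
      using p by (simp_all add: permutes_inverses)
    have "?h -` box l u = box (\<chi> i. l $ inv p i) (\<chi> i. u $ inv p i)"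
      by (auto simp: mem_box_cart) (metis pinv)+
    then have "emeasure (distr lborel borel ?h) (box l u) = emeasure lborel (box (\<chi> i. l $ inv p i) (\<chi> i. u $ inv p i))"
      by (subst emeasure_distr) auto
    also have "\<dots> = ennreal (\<Prod>i\<in>UNIV. u $ inv p i - l $ inv p i)"
    proof (subst emeasure_lborel_box)
      fix b :: "real^'n" assume "b \<in> Basis"
      then show "(\<chi> i. l $ inv p i) \<bullet> b \<le> (\<chi> i. u $ inv p i) \<bullet> b"
        using le' by (auto simp: Basis_vec_def inner_axis)
    qed (simp add: prod_Basis_cart inner_axis)
    also have "(\<Prod>i\<in>UNIV. u $ inv p i - l $ inv p i) = (\<Prod>i\<in>UNIV. u $ i - l $ i)"
      using prod.permute[OF permutes_inv[OF p], of "\<lambda>i. u $ i - l $ i"] by (simp add: o_def)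
    finally show "emeasure (distr lborel borel ?h) (box l u) = (\<Prod>b\<in>Basis. (u - l) \<bullet> b)"
      by (simp add: prod_Basis_cart inner_axis)
  qed simp
  then have "(\<integral>\<^sup>+x. g x \<partial>lborel) = (\<integral>\<^sup>+x. g x \<partial>distr lborel borel ?h)" by simp
  then show ?thesis by (simp add: nn_integral_distr)
qed

lemma nn_integral_lborel_diagonal:
  fixes g :: "real^'n \<Rightarrow> ennreal"
  assumes [measurable]: "g \<in> borel_measurable borel" and c: "\<And>i. c i \<noteq> 0"
  shows "ennreal (\<Prod>i\<in>UNIV. \<bar>c i\<bar>) * (\<integral>\<^sup>+x. g (\<chi> i. c i * x $ i) \<partial>lborel) = (\<integral>\<^sup>+x. g x \<partial>lborel)"
proof -
  let ?c = "\<lambda>b::real^'n. (\<chi> i. c i) \<bullet> b"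
  let ?T = "\<lambda>x::real^'n. 0 + (\<Sum>j\<in>Basis. (?c j * (x \<bullet> j)) *\<^sub>R j)"
  have nz: "?c j \<noteq> 0" if "j \<in> Basis" for j
    using that c by (auto simp: Basis_vec_def inner_axis)
  define T where "T = (\<lambda>x::real^'n. \<chi> i. c i * x $ i)"
  have T: "?T = T"
  proof
    fix x :: "real^'n"
    have "?T x \<bullet> b = T x \<bullet> b" if "b \<in> Basis" for b
    proof -
      have "?T x \<bullet> b = ?c b * (x \<bullet> b)"
        using that by simp
      also have "\<dots> = T x \<bullet> b"
        using that by (auto simp: Basis_vec_def inner_axis T_def)
      finally show ?thesis .
    qed
    then show "?T x = T x"
      by (rule euclidean_eqI)
  qed
  have "?T \<in> borel_measurable borel" by simp
  then have [measurable]: "T \<in> borel_measurable borel" unfolding T .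
  have "lborel = density (distr lborel borel T) (\<lambda>_. ennreal (\<Prod>j\<in>Basis. \<bar>?c j\<bar>))"
    using lborel_affine_euclidean[of ?c 0] nz unfolding T by simp
  then have "(\<integral>\<^sup>+x. g x \<partial>lborel) = (\<integral>\<^sup>+x. g x \<partial>density (distr lborel borel T) (\<lambda>_. ennreal (\<Prod>j\<in>Basis. \<bar>?c j\<bar>)))"
    by simp
  also have "\<dots> = ennreal (\<Prod>j\<in>Basis. \<bar>?c j\<bar>) * (\<integral>\<^sup>+x. g (T x) \<partial>lborel)"
    by (simp add: nn_integral_density nn_integral_distr nn_integral_cmult)
  finally show ?thesis by (simp add: prod_Basis_cart inner_axis T_def)
qed

text \<open>Every linear map is a composition of scalings, transpositions of coordinates, shears and maps into a
coordinate hyperplane. The transformation rule is multiplicative under composition, and a factor of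
the last kind would make the determinant vanish.\<close>
lemma nn_integral_lborel_linear:
  fixes f :: "real^'n \<Rightarrow> real^'n" and g :: "real^'n \<Rightarrow> ennreal"
  assumes "linear f" and "det (matrix f) \<noteq> 0" and "g \<in> borel_measurable borel"
  shows "ennreal \<bar>det (matrix f)\<bar> * (\<integral>\<^sup>+x. g (f x) \<partial>lborel) = (\<integral>\<^sup>+x. g x \<partial>lborel)"
proof -
  let ?P = "\<lambda>f. det (matrix f) \<noteq> 0 \<longrightarrow> (\<forall>g\<in>borel_measurable borel.
     ennreal \<bar>det (matrix f)\<bar> * (\<integral>\<^sup>+x. g (f x) \<partial>lborel) = (\<integral>\<^sup>+x. g x \<partial>(lborel :: (real^'n) measure)))"
  have "?P f"
  proof (rule induct_linear_elementary[OF assms(1)])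
    fix f h :: "real^'n \<Rightarrow> real^'n"
    assume lin: "linear f" "linear h" and f: "?P f" and h: "?P h"
    have m: "matrix (f \<circ> h) = matrix f ** matrix h"
      using lin by (simp add: matrix_compose)
    show "?P (f \<circ> h)"
    proof (intro impI ballI)
      assume "det (matrix (f \<circ> h)) \<noteq> 0"
      then have nz: "det (matrix f) \<noteq> 0" "det (matrix h) \<noteq> 0" by (auto simp: m det_mul)
      fix g :: "real^'n \<Rightarrow> ennreal" assume g[measurable]: "g \<in> borel_measurable borel"
      have [measurable]: "f \<in> borel_measurable borel"
        using lin by (intro borel_measurable_continuous_onI linear_continuous_on) (simp add: linear_conv_bounded_linear)
      have "(\<lambda>x. g (f x)) \<in> borel_measurable borel" by measurable
      from bspec[OF mp[OF h nz(2)] this]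
      have "ennreal \<bar>det (matrix h)\<bar> * (\<integral>\<^sup>+x. g (f (h x)) \<partial>lborel) = (\<integral>\<^sup>+x. g (f x) \<partial>lborel)" .
      moreover have "ennreal \<bar>det (matrix f)\<bar> * (\<integral>\<^sup>+x. g (f x) \<partial>lborel) = (\<integral>\<^sup>+x. g x \<partial>lborel)"
        using f nz g by blast
      ultimately show "ennreal \<bar>det (matrix (f \<circ> h))\<bar> * (\<integral>\<^sup>+x. g ((f \<circ> h) x) \<partial>lborel) = (\<integral>\<^sup>+x. g x \<partial>lborel)"
        by (simp add: m det_mul abs_mult ennreal_mult mult.assoc)
    qed
  next
    fix f :: "real^'n \<Rightarrow> real^'n" and i assume "linear f" "\<And>x. f x $ i = 0"
    then have "\<not> inj f"
      by (metis (full_types) linear_injective_imp_surjective one_neq_zero surjE vec_component)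
    then show "?P f" using det_nz_iff_inj[OF \<open>linear f\<close>] by blast
  next
    fix c :: "'n \<Rightarrow> real"
    have "det (matrix (\<lambda>x::real^'n. \<chi> i. c i * x $ i)) = (\<Prod>i\<in>UNIV. c i)"
      by (subst det_diagonal) (auto simp: matrix_def axis_def)
    then show "?P (\<lambda>x. \<chi> i. c i * x $ i)"
      using nn_integral_lborel_diagonal[of _ c] by (auto simp: abs_prod)
  next
    fix m n :: 'n assume "m \<noteq> n"
    let ?h = "\<lambda>v::real^'n. \<chi> i. v $ Transposition.transpose m n i"
    have p: "Transposition.transpose m n permutes UNIV" by (simp add: permutes_swap_id)
    have "matrix ?h = (\<chi> i. mat 1 $ Transposition.transpose m n i)"
      by (auto simp: matrix_def axis_def mat_def vec_eq_iff)
    then have "\<bar>det (matrix ?h)\<bar> = 1"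
      using \<open>m \<noteq> n\<close> by (simp add: det_permute_rows[OF p] sign_swap_id)
    then show "?P ?h" using nn_integral_lborel_permute[OF _ p] by auto
  next
    fix m n :: 'n assume mn: "m \<noteq> n"
    let ?h = "\<lambda>v::real^'n. \<chi> i. if i = m then v $ m + v $ n else v $ i"
    have "matrix ?h = (\<chi> k. if k = m then row m (mat 1) + 1 *s row n (mat 1) else row k (mat 1))"
      by (auto simp: matrix_def axis_def mat_def vec_eq_iff row_def)
    also have "det \<dots> = det (mat 1 :: real^'n^'n)"
      by (rule det_row_operation[OF mn])
    finally have "det (matrix ?h) = 1" by simp
    moreover have "?h x = x + (x $ n) *\<^sub>R axis m 1" for x
      by (auto simp: vec_eq_iff axis_def)
    ultimately show "?P ?h" using nn_integral_lborel_shear[OF mn] by simp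
  qed
  with assms show ?thesis by blast
qed

section \<open>Factoring positive definite matrices\<close>

lemma inner_symmetric_matrix:
  fixes A :: "real^'n^'n" assumes "transpose A = A"
  shows "x \<bullet> (A *v y) = y \<bullet> (A *v x)"
  by (metis assms dot_lmul_matrix inner_commute transpose_matrix_vector)

text \<open>Gram-Schmidt orthonormalisation for the inner product \<open>x \<bullet> (A *v y)\<close>, one coordinate index
at a time; the columns of \<open>V\<close> are the resulting basis.\<close>
lemma sym_pos_def_orthonormal_basis:
  fixes A :: "real^'n^'n"
  assumes "sym_pos_def A"
  obtains V :: "real^'n^'n" where "transpose V ** A ** V = mat 1"
proof -
  have pos: "x \<bullet> (A *v x) > 0" if "x \<noteq> 0" for x
    using assms that by (auto simp: sym_pos_def_def)
  have sym: "x \<bullet> (A *v y) = y \<bullet> (A *v x)" for x y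
    using assms by (intro inner_symmetric_matrix) (simp add: sym_pos_def_def)
  have "\<exists>v :: 'n \<Rightarrow> real^'n. \<forall>i\<in>I. \<forall>j\<in>I. v i \<bullet> (A *v v j) = (if i = j then 1 else 0)" for I
  proof (induction I rule: finite_induct[OF finite])
    case 1 show ?case by simp
  next
    case (2 k I)
    then obtain v where v: "\<And>i j. i \<in> I \<Longrightarrow> j \<in> I \<Longrightarrow> v i \<bullet> (A *v v j) = (if i = j then 1 else 0)"
      by blast
    have "dim (v ` I) \<le> card I" by (rule order_trans[OF dim_le_card'[of "v ` I"] card_image_le]) (auto simp: finite)
    also have "card I < DIM(real^'n)"
    proof -
      have "I \<subset> UNIV" using 2 by auto
      then show ?thesis by (simp add: psubset_card_mono)
    qed
    finally have "span (v ` I) \<noteq> UNIV" by (metis dim_span dim_UNIV less_irrefl)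
    then obtain x where x: "x \<notin> span (v ` I)" by auto
    define y where "y = x - (\<Sum>i\<in>I. (v i \<bullet> (A *v x)) *\<^sub>R v i)"
    have "y \<noteq> 0"
    proof
      assume "y = 0"
      then have "x = (\<Sum>i\<in>I. (v i \<bullet> (A *v x)) *\<^sub>R v i)" by (simp add: y_def)
      also have "\<dots> \<in> span (v ` I)" by (intro span_sum span_scale span_base) auto
      finally show False using x by simp
    qed
    note yp = pos[OF this]
    have vy: "v j \<bullet> (A *v y) = 0" if "j \<in> I" for j
    proof -
      have "(\<Sum>i\<in>I. (v i \<bullet> (A *v x)) * (v j \<bullet> (A *v v i))) = v j \<bullet> (A *v x)"
        using that by (simp add: v if_distrib sum.delta' cong: if_cong sum.cong)
      then show ?thesis
        by (simp add: y_def matrix_vector_mult_diff_distrib inner_diff_right inner_sum_right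
            linear_sum[OF matrix_vector_mul_linear] matrix_vector_mult_scaleR)
    qed
    define z where "z = (1 / sqrt (y \<bullet> (A *v y))) *\<^sub>R y"
    have zz: "z \<bullet> (A *v z) = 1" and vz: "\<And>j. j \<in> I \<Longrightarrow> v j \<bullet> (A *v z) = 0"
      using yp vy by (auto simp: z_def matrix_vector_mult_scaleR)
    have zv: "\<And>j. j \<in> I \<Longrightarrow> z \<bullet> (A *v v j) = 0" using vz sym by metis
    show ?case
      by (rule exI[of _ "v(k := z)"]) (use 2 v zz vz zv in auto)
  qed
  then obtain v :: "'n \<Rightarrow> real^'n" where v: "\<And>i j. v i \<bullet> (A *v v j) = (if i = j then 1 else 0)"
    by (meson iso_tuple_UNIV_I)
  define V where "V = (\<chi> i j. v j $ i)"
  have col: "V *v axis j 1 = v j" for j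
    by (simp add: V_def matrix_vector_mult_basis column_def vec_eq_iff)
  have "(transpose V ** A ** V) $ i $ j = v i \<bullet> (A *v v j)" for i j
  proof -
    have "(transpose V ** A ** V) $ i $ j = axis i 1 \<bullet> ((transpose V ** A ** V) *v axis j 1)"
      by (simp add: inner_axis' matrix_vector_mult_basis column_def)
    also have "\<dots> = axis i 1 \<bullet> (transpose V *v (A *v (V *v axis j 1)))"
      by (simp only: matrix_vector_mul_assoc matrix_mul_assoc)
    also have "\<dots> = (V *v axis i 1) \<bullet> (A *v (V *v axis j 1))"
      by (subst inner_commute, subst transpose_matrix_vector, subst dot_lmul_matrix) (rule inner_commute)
    finally show ?thesis by (simp only: col)
  qed
  then have "transpose V ** A ** V = mat 1"
    by (simp add: v vec_eq_iff mat_def)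
  then show ?thesis by (rule that)
qed

text \<open>If the columns of \<open>V\<close> are orthonormal for \<open>A\<close>, the inverse transpose of \<open>V\<close> serves as \<open>L\<close>.\<close>
lemma sym_pos_def_factor:
  fixes A :: "real^'n^'n"
  assumes "sym_pos_def A"
  obtains L :: "real^'n^'n" where "A = L ** transpose L" and "invertible L"
proof -
  obtain V :: "real^'n^'n" where V: "transpose V ** A ** V = mat 1"
    using sym_pos_def_orthonormal_basis[OF assms] .
  then have iV: "invertible V"
    by (metis invertible_left_inverse)
  define L where "L = matrix_inv (transpose V)"
  have iT: "invertible (transpose V)" using iV by (simp add: invertible_det_nz)
  have L: "L ** transpose V = mat 1" "transpose V ** L = mat 1"
    using matrix_inv_left_right[OF iT] by (simp_all add: L_def)
  have "V ** transpose L = mat 1" using arg_cong[OF L(1), of transpose]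
    by (simp add: matrix_transpose_mul)
  then have "L ** transpose L = L ** (transpose V ** A ** V) ** transpose L"
    by (simp add: V)
  also have "\<dots> = (L ** transpose V) ** A ** (V ** transpose L)"
    by (simp add: matrix_mul_assoc)
  finally have "A = L ** transpose L" using L \<open>V ** transpose L = mat 1\<close> by simp
  moreover have "invertible L" using L invertible_def by blast
  ultimately show ?thesis by (rule that)
qed

section \<open>Gaussian measures as affine images of the standard one\<close>

lemma borel_measurable_linear:
  fixes f :: "real^'m \<Rightarrow> real^'n"
  assumes "linear f"
  shows "f \<in> borel_measurable borel"
  using assms by (intro borel_measurable_continuous_onI linear_continuous_on)
    (simp add: linear_conv_bounded_linear)

lemma borel_measurable_matrix_vector_mult [measurable]:
  fixes A :: "real^'m^'n"
  shows "(\<lambda>x. A *v x) \<in> borel_measurable borel"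
  by (rule borel_measurable_linear[OF matrix_vector_mul_linear])

lemma sets_gaussian [measurable_cong, simp]: "sets (gaussian \<mu> \<Phi>) = sets borel"
  by (simp add: gaussian_def)

abbreviation std_gaussian :: "(real^'n) measure" where
  "std_gaussian \<equiv> gaussian 0 (mat 1)"

lemma matrix_inv_mat_1 [simp]: "matrix_inv (mat 1 :: real^'n^'n) = mat 1"
  by (rule matrix_inv_unique) simp

text \<open>The change of variables \<open>y = \<mu> + L z\<close> turns the quadratic form of the covariance \<open>L L'\<close> into
\<open>z \<bullet> z\<close>, and its Jacobian cancels the determinant in the density.\<close>
lemma gaussian_affine:
  fixes L :: "real^'n^'n"
  assumes "invertible L"
  shows "gaussian \<mu> (L ** transpose L) = distr std_gaussian borel (\<lambda>z. \<mu> + L *v z)"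
proof (rule measure_eqI)
  show "sets (gaussian \<mu> (L ** transpose L)) = sets (distr std_gaussian borel (\<lambda>z. \<mu> + L *v z))"
    by (simp add: gaussian_def)
  fix S assume "S \<in> sets (gaussian \<mu> (L ** transpose L))"
  then have [measurable]: "S \<in> sets borel" by (simp add: gaussian_def)
  have aff [measurable]: "(\<lambda>z. \<mu> + L *v z) \<in> borel_measurable borel" by measurable
  have pre [measurable]: "(\<lambda>z. \<mu> + L *v z) -` S \<in> sets borel"
    using measurable_sets[OF aff \<open>S \<in> sets borel\<close>] by simp
  let ?K = "matrix_inv L"
  have K: "?K ** L = mat 1" "L ** ?K = mat 1" using matrix_inv_left_right[OF assms] by auto
  have inv: "matrix_inv (L ** transpose L) = transpose ?K ** ?K"
  proof (rule matrix_inv_unique)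
    have "L ** transpose L ** (transpose ?K ** ?K) = L ** (transpose (?K ** L)) ** ?K"
      by (simp add: matrix_transpose_mul matrix_mul_assoc)
    then show "L ** transpose L ** (transpose ?K ** ?K) = mat 1" by (simp add: K)
  qed
  have detL: "det L \<noteq> 0" using assms by (simp add: invertible_det_nz)
  let ?n = "CARD('n)"
  let ?h = "\<lambda>y. ennreal (exp (- ((y - \<mu>) \<bullet> (matrix_inv (L ** transpose L) *v (y - \<mu>))) / 2) / sqrt ((2 * pi) ^ ?n * det (L ** transpose L))) * indicator S y"
  let ?k = "\<lambda>x. ennreal (exp (- (x \<bullet> x) / 2) / sqrt ((2 * pi) ^ ?n))"
  have [measurable]: "?h \<in> borel_measurable borel" by measurable
  have shift: "(\<integral>\<^sup>+y. g (\<mu> + y) \<partial>lborel) = (\<integral>\<^sup>+y. g y \<partial>lborel)" if [measurable]: "g \<in> borel_measurable borel" for g :: "real^'n \<Rightarrow> ennreal"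
  proof -
    have "(\<integral>\<^sup>+y. g y \<partial>lborel) = (\<integral>\<^sup>+y. g y \<partial>distr lborel borel ((+) \<mu>))"
      by (simp add: lborel_distr_plus)
    then show ?thesis by (simp add: nn_integral_distr)
  qed
  have quad: "(L *v x) \<bullet> (transpose ?K ** ?K *v (L *v x)) = x \<bullet> x" for x
  proof -
    have "(L *v x) \<bullet> (transpose ?K ** ?K *v (L *v x)) = (?K *v (L *v x)) \<bullet> (?K *v (L *v x))"
      by (subst inner_commute) (simp only: matrix_vector_mul_assoc[symmetric] transpose_matrix_vector dot_lmul_matrix)
    then show ?thesis by (simp add: matrix_vector_mul_assoc K)
  qed
  have "emeasure (gaussian \<mu> (L ** transpose L)) S = (\<integral>\<^sup>+y. ?h y \<partial>lborel)"
    unfolding gaussian_def by (subst emeasure_density) auto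
  also have "\<dots> = (\<integral>\<^sup>+y. ?h (\<mu> + y) \<partial>lborel)"
    by (rule shift[symmetric]) measurable
  also have "\<dots> = ennreal \<bar>det L\<bar> * (\<integral>\<^sup>+x. ?h (\<mu> + L *v x) \<partial>lborel)"
    using nn_integral_lborel_linear[of "(*v) L" "\<lambda>y. ?h (\<mu> + y)"] detL by simp
  also have "\<dots> = (\<integral>\<^sup>+x. ennreal \<bar>det L\<bar> * ?h (\<mu> + L *v x) \<partial>lborel)"
    by (subst nn_integral_cmult) auto
  also have "\<dots> = (\<integral>\<^sup>+x. ?k x * indicator S (\<mu> + L *v x) \<partial>lborel)"
  proof (rule nn_integral_cong)
    fix x :: "real^'n"
    show "ennreal \<bar>det L\<bar> * ?h (\<mu> + L *v x) = ?k x * indicator S (\<mu> + L *v x)"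
      using detL by (simp add: inv quad det_mul real_sqrt_mult ennreal_mult'[symmetric] indicator_def)
  qed
  also have "\<dots> = (\<integral>\<^sup>+x. ?k x * indicator ((\<lambda>z. \<mu> + L *v z) -` S) x \<partial>lborel)"
    by (simp add: indicator_def)
  also have "\<dots> = emeasure std_gaussian ((\<lambda>z. \<mu> + L *v z) -` S)"
    unfolding gaussian_def by (subst emeasure_density) (auto simp: pre)
  also have "\<dots> = emeasure (distr std_gaussian borel (\<lambda>z. \<mu> + L *v z)) S"
    by (subst emeasure_distr) (auto simp: gaussian_def)
  finally show "emeasure (gaussian \<mu> (L ** transpose L)) S = emeasure (distr std_gaussian borel (\<lambda>z. \<mu> + L *v z)) S" .
qed

lemma prob_space_std_gaussian: "prob_space (std_gaussian :: (real^'n) measure)"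
proof
  let ?n = "CARD('n)"
  have "ennreal (exp (- (x \<bullet> x) / 2) / sqrt ((2 * pi) ^ ?n)) = (\<Prod>b\<in>Basis. ennreal (std_normal_density (x \<bullet> b)))" for x :: "real^'n"
  proof -
    have "(\<Prod>b\<in>Basis. std_normal_density (x \<bullet> b)) = (\<Prod>i\<in>UNIV. (1 / sqrt (2*pi)) * exp (- (x $ i)\<^sup>2 / 2))"
      by (simp add: prod_Basis_cart std_normal_density_def inner_axis)
    also have "\<dots> = (1 / sqrt (2*pi)) ^ ?n * exp (- (x \<bullet> x) / 2)"
      by (simp only: prod.distrib prod_constant exp_sum[OF finite, symmetric]) (simp add: inner_vec_def power2_eq_square sum_divide_distrib sum_negf)
    also have "(1 / sqrt (2*pi)) ^ ?n = 1 / sqrt ((2 * pi) ^ ?n)"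
      by (simp only: real_sqrt_power power_divide power_one)
    finally show ?thesis by (simp add: prod_ennreal)
  qed
  then have dens: "ennreal (exp (- ((x - 0) \<bullet> (matrix_inv (mat 1) *v (x - 0))) / 2) / sqrt ((2 * pi) ^ ?n * det (mat 1 :: real^'n^'n)))
      = (\<Prod>b\<in>Basis. ennreal (std_normal_density (x \<bullet> b)))" for x :: "real^'n"
    by (simp only: diff_zero matrix_inv_mat_1 matrix_vector_mul_lid det_I mult_1_right)
  have one: "(\<integral>\<^sup>+x. ennreal (std_normal_density x) \<partial>lborel) = 1"
    using prob_space.emeasure_space_1[OF prob_space_normal_density[of 1 0]]
    by (simp add: emeasure_density)
  have "emeasure (std_gaussian :: (real^'n) measure) (space std_gaussian)
      = (\<integral>\<^sup>+x. (\<Prod>b\<in>Basis. ennreal (std_normal_density (x \<bullet> b))) \<partial>(lborel :: (real^'n) measure))"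
    unfolding gaussian_def dens by (subst emeasure_density) auto
  also have "\<dots> = (\<Prod>b\<in>(Basis :: (real^'n) set). (\<integral>\<^sup>+x. ennreal (std_normal_density x) \<partial>lborel))"
    by (rule nn_integral_lborel_prod) auto
  finally show "emeasure (std_gaussian :: (real^'n) measure) (space std_gaussian) = 1"
    by (simp add: one)
qed

text \<open>That the density integrates to one for every covariance matrix, not only for a diagonal one, is what
bounds rejection probabilities by one over the whole covariance model.\<close>
lemma prob_space_gaussian:
  fixes \<Phi> :: "real^'n^'n"
  assumes "sym_pos_def \<Phi>"
  shows "prob_space (gaussian \<mu> \<Phi>)"
proof -
  obtain L :: "real^'n^'n" where L: "\<Phi> = L ** transpose L" "invertible L"
    using sym_pos_def_factor[OF assms] .
  have "(\<lambda>z. \<mu> + L *v z) \<in> borel_measurable borel" by measurable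
  then have "(\<lambda>z. \<mu> + L *v z) \<in> borel_measurable std_gaussian"
    by (simp cong: measurable_cong_sets)
  then show ?thesis unfolding L(1) gaussian_affine[OF L(2)]
    by (rule prob_space.prob_space_distr[OF prob_space_std_gaussian])
qed

section \<open>Least squares projections\<close>

lemma invertible_gram:
  fixes X :: "real^'k^'n"
  assumes "rank X = CARD('k)"
  shows "invertible (transpose X ** X)"
proof (rule invertible_of_pos_def)
  fix x :: "real^'k" assume "x \<noteq> 0"
  have "inj ((*v) X)" using assms full_rank_injective by blast
  then have "X *v x \<noteq> 0" using \<open>x \<noteq> 0\<close> by (metis injD matrix_vector_mult_0_right)
  then show "x \<bullet> (transpose X ** X *v x) > 0"
    by (simp add: matrix_vector_mul_assoc[symmetric] inner_matrix_transpose[of x "transpose X"] transpose_transpose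
        del: transpose_matrix_vector)
qed

text \<open>The matrix of the map \<open>y \<mapsto> R \<beta>\<close> with \<open>\<beta>\<close> the least squares estimate; the rank
condition is about its columns.\<close>
definition contrast :: "real^'k^'n \<Rightarrow> real^'k^'q \<Rightarrow> real^'n^'q" where
  "contrast X R = R ** matrix_inv (transpose X ** X) ** transpose X"

lemma restricted_beta_hat: "R *v beta_hat X y = contrast X R *v y"
  by (simp add: beta_hat_def contrast_def matrix_vector_mul_assoc matrix_mul_assoc)

lemma linear_beta_hat: "linear (beta_hat X)"
  unfolding beta_hat_def[abs_def] by (rule matrix_vector_mul_linear)

lemma linear_u_hat: "linear (u_hat X)"
  unfolding u_hat_def[abs_def]
  by (intro linear_compose_sub linear_ident
      linear_compose[OF linear_beta_hat matrix_vector_mul_linear, unfolded o_def])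

lemma beta_hat_design:
  fixes X :: "real^'k^'n"
  assumes "rank X = CARD('k)"
  shows "beta_hat X (X *v b) = b"
  using matrix_inv_left_right(2)[OF invertible_gram[OF assms]]
  by (simp add: beta_hat_def matrix_vector_mul_assoc matrix_mul_assoc[symmetric])

lemma u_hat_design:
  fixes X :: "real^'k^'n"
  assumes "rank X = CARD('k)"
  shows "u_hat X (X *v b) = 0"
  by (simp add: u_hat_def beta_hat_design[OF assms])

text \<open>The residual map is an orthogonal projection, hence self-adjoint.\<close>
lemma inner_u_hat:
  fixes X :: "real^'k^'n"
  assumes "rank X = CARD('k)"
  shows "x \<bullet> u_hat X y = u_hat X x \<bullet> y"
proof -
  let ?P = "X ** matrix_inv (transpose X ** X) ** transpose X"
  have "transpose ?P = ?P"
    using transpose_matrix_inv[OF invertible_gram[OF assms]]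
    by (simp add: matrix_transpose_mul matrix_mul_assoc transpose_transpose)
  then have "x \<bullet> (?P *v y) = (?P *v x) \<bullet> y" by (metis inner_matrix_transpose)
  then show ?thesis
    by (simp add: u_hat_def beta_hat_def inner_diff_left inner_diff_right matrix_vector_mul_assoc matrix_mul_assoc)
qed

lemma u_hat_axis_eq_0_iff:
  fixes X :: "real^'k^'n"
  assumes "rank X = CARD('k)"
  shows "u_hat X (axis j 1) = 0 \<longleftrightarrow> axis j 1 \<in> span (columns X)"
proof -
  have "columns X = range (\<lambda>i. X *v axis i 1)"
    by (auto simp: columns_def matrix_vector_mult_basis)
  have "span (columns X) = range ((*v) X)"
  proof
    show "span (columns X) \<subseteq> range ((*v) X)"
      by (rule span_minimal) (auto simp: \<open>columns X = _\<close> intro: linear_subspace_image matrix_vector_mul_linear)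
    show "range ((*v) X) \<subseteq> span (columns X)"
      by (auto simp: matrix_vector_mult_in_columnspace)
  qed
  then show ?thesis
    using u_hat_design[OF assms] by (auto simp: u_hat_def image_iff)
qed

section \<open>The covariance estimator\<close>

lemma contrast_transpose_component: "(transpose (contrast X R) *v a) $ j = column j (contrast X R) \<bullet> a"
  by (simp add: transpose_def column_def matrix_vector_mult_def inner_vec_def)

text \<open>This expansion is the source of the following properties of the covariance estimator: symmetry,
nonnegativity, the description of its kernel, and continuity.\<close>
lemma Omega_Het_form:
  fixes X :: "real^'k^'n"
  assumes "rank X = CARD('k)"
  shows "a \<bullet> (Omega_Het X R d y *v b) = (\<Sum>j\<in>UNIV. d $ j * (u_hat X y $ j)\<^sup>2 *
      (column j (contrast X R) \<bullet> a) * (column j (contrast X R) \<bullet> b))"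
proof -
  let ?G = "contrast X R" and ?D = "diag (\<chi> i. d $ i * (u_hat X y $ i)\<^sup>2)"
  have "transpose ?G = X ** matrix_inv (transpose X ** X) ** transpose R"
    using transpose_matrix_inv[OF invertible_gram[OF assms]]
    by (simp add: contrast_def matrix_transpose_mul matrix_mul_assoc transpose_transpose)
  then have "Omega_Het X R d y = ?G ** ?D ** transpose ?G"
    by (simp add: Omega_Het_def Psi_Het_def contrast_def matrix_mul_assoc)
  then have "a \<bullet> (Omega_Het X R d y *v b) = (transpose ?G *v a) \<bullet> (?D *v (transpose ?G *v b))"
    by (simp add: matrix_vector_mul_assoc[symmetric] inner_matrix_transpose del: transpose_matrix_vector)
  then show ?thesis
    by (simp add: inner_vec_def[of "transpose ?G *v a"] diag_mult_vec contrast_transpose_component mult_ac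
        del: transpose_matrix_vector)
qed

lemma Omega_Het_sym:
  fixes X :: "real^'k^'n"
  assumes "rank X = CARD('k)"
  shows "a \<bullet> (Omega_Het X R d y *v b) = b \<bullet> (Omega_Het X R d y *v a)"
  by (simp add: Omega_Het_form[OF assms] mult_ac)

lemma Omega_Het_nonneg:
  fixes X :: "real^'k^'n"
  assumes "rank X = CARD('k)" and "\<forall>i. d $ i > 0"
  shows "a \<bullet> (Omega_Het X R d y *v a) \<ge> 0"
  unfolding Omega_Het_form[OF assms(1)] using assms(2)
  by (intro sum_nonneg) (simp add: less_imp_le mult.assoc)

lemma Omega_Het_null:
  fixes X :: "real^'k^'n"
  assumes "rank X = CARD('k)" and "\<forall>i. d $ i > 0" and "a \<bullet> (Omega_Het X R d y *v a) = 0"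
  shows "u_hat X y $ j = 0 \<or> column j (contrast X R) \<bullet> a = 0"
proof -
  have "(\<Sum>j\<in>UNIV. d $ j * (u_hat X y $ j)\<^sup>2 * (column j (contrast X R) \<bullet> a) * (column j (contrast X R) \<bullet> a)) = 0"
    using assms(3) by (simp add: Omega_Het_form[OF assms(1)])
  then have "d $ j * (u_hat X y $ j)\<^sup>2 * (column j (contrast X R) \<bullet> a) * (column j (contrast X R) \<bullet> a) = 0"
    using assms(2) by (subst (asm) sum_nonneg_eq_0_iff) (auto simp: less_imp_le mult.assoc)
  then show ?thesis using assms(2) by (auto simp: less_irrefl dest: spec[of _ j])
qed

lemma Omega_Het_nonsingular:
  fixes X :: "real^'k^'n"
  assumes "rank X = CARD('k)" and "\<forall>i. d $ i > 0"
    and "\<And>a. (\<And>j. u_hat X y $ j = 0 \<or> column j (contrast X R) \<bullet> a = 0) \<Longrightarrow> a = 0"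
  shows "det (Omega_Het X R d y) \<noteq> 0"
  unfolding det_nz_iff_kernel
  using Omega_Het_null[OF assms(1,2)] assms(3) by (metis inner_zero_right)

lemma B_Het_transpose_component:
  "(transpose (B_Het X R y) *v a) $ j = u_hat X y $ j * (column j (contrast X R) \<bullet> a)"
proof -
  have "B_Het X R y = contrast X R ** diag (u_hat X y)"
    by (simp add: B_Het_def contrast_def)
  moreover have "transpose (diag (u_hat X y)) = diag (u_hat X y)"
    by (simp add: diag_def transpose_def vec_eq_iff)
  ultimately have "transpose (B_Het X R y) *v a = diag (u_hat X y) *v (transpose (contrast X R) *v a)"
    by (simp add: matrix_transpose_mul matrix_vector_mul_assoc del: transpose_matrix_vector)
  then show ?thesis by (simp add: diag_mult_vec contrast_transpose_component del: transpose_matrix_vector)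
qed

lemma Omega_Het_nonsingular_of_rank:
  fixes X :: "real^'k^'n" and R :: "real^'k^'q"
  assumes "rank X = CARD('k)" and "\<forall>i. d $ i > 0" and "rank (B_Het X R y) = CARD('q)"
  shows "det (Omega_Het X R d y) \<noteq> 0"
proof (rule Omega_Het_nonsingular[OF assms(1,2)])
  fix a assume "\<And>j. u_hat X y $ j = 0 \<or> column j (contrast X R) \<bullet> a = 0"
  then have "transpose (B_Het X R y) *v a = 0"
    by (simp add: vec_eq_iff B_Het_transpose_component del: transpose_matrix_vector)
  moreover have "inj ((*v) (transpose (B_Het X R y)))"
    using assms(3) by (simp add: full_rank_injective[symmetric] rank_transpose)
  ultimately show "a = 0" by (metis injD matrix_vector_mult_0_right)
qed

lemma Omega_Het_eq_0:
  fixes X :: "real^'k^'n"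
  assumes "rank X = CARD('k)" and "B_Het X R y = 0"
  shows "Omega_Het X R d y = 0"
proof -
  have z: "u_hat X y $ j * (column j (contrast X R) \<bullet> a) = 0" for j a
    unfolding B_Het_transpose_component[symmetric] using assms(2) by (simp add: transpose_def matrix_vector_mult_def)
  have "a \<bullet> (Omega_Het X R d y *v b) = 0" for a b
    unfolding Omega_Het_form[OF assms(1)]
    using z by (intro sum.neutral ballI) (auto simp: power2_eq_square)
  then have "Omega_Het X R d y *v b = 0" for b by (metis inner_eq_zero_iff)
  then show ?thesis by (simp add: matrix_eq)
qed

text \<open>The columns surviving in the rank condition span the whole space, so a vector in the kernel of the
estimator is orthogonal to everything as soon as no corresponding residual vanishes.\<close>
lemma Omega_Het_nonsingular_of_residuals:
  fixes X :: "real^'k^'n" and R :: "real^'k^'q"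
  assumes "rank X = CARD('k)" and "\<forall>i. d $ i > 0" and "rank_condition X R"
    and nz: "\<And>j. axis j 1 \<notin> span (columns X) \<Longrightarrow> u_hat X y $ j \<noteq> 0"
  shows "det (Omega_Het X R d y) \<noteq> 0"
proof (rule Omega_Het_nonsingular[OF assms(1,2)])
  fix a assume a: "\<And>j. u_hat X y $ j = 0 \<or> column j (contrast X R) \<bullet> a = 0"
  let ?S = "{column i (contrast X R) | i. axis i 1 \<notin> span (columns X)}"
  have "dim ?S = DIM(real^'q)"
    using assms(3) by (simp add: rank_condition_def contrast_def)
  then have "a \<in> span ?S" using iffD1[OF dim_eq_full, of ?S] by simp
  moreover have "orthogonal a s" if "s \<in> ?S" for s
    using that a nz by (auto simp: orthogonal_def inner_commute)
  ultimately have "orthogonal a a"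
    by (metis (no_types, lifting) orthogonal_to_span)
  then show "a = 0" by (simp add: orthogonal_def)
qed

lemma tendsto_linear:
  fixes L :: "real^'m \<Rightarrow> real^'n"
  assumes "linear L" and "(f \<longlongrightarrow> y) F"
  shows "((\<lambda>m. L (f m)) \<longlongrightarrow> L y) F"
  using bounded_linear.tendsto[OF _ assms(2)] assms(1) by (simp add: linear_conv_bounded_linear)

lemma tendsto_Omega_Het:
  fixes X :: "real^'k^'n"
  assumes "rank X = CARD('k)" and "(f \<longlongrightarrow> y) F"
  shows "((\<lambda>m. Omega_Het X R d (f m)) \<longlongrightarrow> Omega_Het X R d y) F"
proof -
  have e: "Omega_Het X R d y $ a $ b = (\<Sum>j\<in>UNIV. d $ j * (u_hat X y $ j)\<^sup>2 *
      (column j (contrast X R) \<bullet> axis a 1) * (column j (contrast X R) \<bullet> axis b 1))" for y a b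
  proof -
    have "Omega_Het X R d y $ a $ b = axis a 1 \<bullet> (Omega_Het X R d y *v axis b 1)"
      by (simp add: inner_axis' matrix_vector_mult_basis column_def)
    also note Omega_Het_form[OF assms(1)]
    finally show ?thesis .
  qed
  note u = tendsto_vec_nth[OF tendsto_linear[OF linear_u_hat assms(2)]]
  have "((\<lambda>m. Omega_Het X R d (f m) $ a $ b) \<longlongrightarrow> Omega_Het X R d y $ a $ b) F" for a b
    unfolding e by (rule tendsto_sum, rule tendsto_mult, rule tendsto_mult, rule tendsto_mult,
      rule tendsto_const, rule tendsto_power, rule u, rule tendsto_const, rule tendsto_const)
  then show ?thesis
    by (rule vec_tendstoI[OF vec_tendstoI])
qed

section \<open>The test statistic\<close>

lemma tendsto_T_Het:
  fixes X :: "real^'k^'n"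
  assumes X: "rank X = CARD('k)" and f: "(f \<longlongrightarrow> y) F" and nz: "det (Omega_Het X R d y) \<noteq> 0"
  shows "((\<lambda>m. T_Het X R r d (f m)) \<longlongrightarrow> T_Het X R r d y) F"
proof -
  note O = tendsto_Omega_Het[OF X f, of R d]
  have v: "((\<lambda>m. R *v beta_hat X (f m) - r) \<longlongrightarrow> R *v beta_hat X y - r) F"
    by (rule tendsto_diff[OF tendsto_linear[OF matrix_vector_mul_linear tendsto_linear[OF linear_beta_hat f]] tendsto_const])
  let ?T = "\<lambda>y. (R *v beta_hat X y - r) \<bullet> (matrix_inv (Omega_Het X R d y) *v (R *v beta_hat X y - r))"
  have "((\<lambda>m. ?T (f m)) \<longlongrightarrow> ?T y) F"
    by (intro tendsto_inner v tendsto_matrix_inv_mult O nz)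
  moreover have "\<forall>\<^sub>F m in F. ?T (f m) = T_Het X R r d (f m)"
    using tendsto_imp_eventually_ne[OF tendsto_det[OF O] nz] by eventually_elim (simp add: T_Het_def)
  ultimately have "((\<lambda>m. T_Het X R r d (f m)) \<longlongrightarrow> ?T y) F"
    by (rule Lim_transform_eventually)
  then show ?thesis using nz by (simp add: T_Het_def)
qed

text \<open>The statistic is continuous on the open set where the covariance estimator is regular and zero elsewhere.\<close>
lemma borel_measurable_T_Het:
  fixes X :: "real^'k^'n"
  assumes X: "rank X = CARD('k)"
  shows "T_Het X R r d \<in> borel_measurable borel"
proof -
  let ?U = "{y. det (Omega_Het X R d y) \<noteq> 0}"
  have "continuous_on UNIV (\<lambda>y. det (Omega_Het X R d y))"
    unfolding continuous_on_def by (intro ballI tendsto_det tendsto_Omega_Het[OF X] tendsto_ident_at)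
  then have "open ?U" by (intro open_Collect_neq continuous_on_const)
  moreover have "continuous_on ?U (T_Het X R r d)"
    unfolding continuous_on_def by (auto intro!: tendsto_T_Het[OF X] tendsto_ident_at)
  ultimately have "(\<lambda>y. if y \<in> ?U then T_Het X R r d y else 0) \<in> borel_measurable borel"
    by (intro borel_measurable_continuous_on_if) auto
  then show ?thesis by (rule back_subst[of "\<lambda>f. f \<in> _"]) (auto simp: T_Het_def)
qed

text \<open>A translation by an element of the null hypothesis leaves the residuals unchanged and moves the
estimate of \<open>R \<beta>\<close> by exactly \<open>r\<close>; the statistic for \<open>r = 0\<close> therefore describes all cases.\<close>
lemma T_Het_shift:
  fixes X :: "real^'k^'n"
  assumes X: "rank X = CARD('k)" and m: "\<mu> \<in> \<MM>\<^sub>0 X R r"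
  shows "T_Het X R r d (y + \<mu>) = T_Het X R 0 d y"
proof -
  obtain b where b: "\<mu> = X *v b" "R *v b = r" using m by (auto simp: \<MM>\<^sub>0_def)
  have "u_hat X (y + \<mu>) = u_hat X y" "beta_hat X (y + \<mu>) = beta_hat X y + b"
    by (simp_all add: b linear_add[OF linear_u_hat] linear_add[OF linear_beta_hat]
        u_hat_design[OF X] beta_hat_design[OF X])
  then show ?thesis
    by (simp add: T_Het_def Omega_Het_def Psi_Het_def b matrix_vector_right_distrib)
qed

lemma T_Het_eqI:
  assumes "det (Omega_Het X R d y) \<noteq> 0" and "Omega_Het X R d y *v w = R *v beta_hat X y - r"
  shows "T_Het X R r d y = (R *v beta_hat X y - r) \<bullet> w"
  using matrix_inv_solves(2)[OF assms(1), of w] assms by (simp add: T_Het_def)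

lemma Omega_Het_scale:
  "Omega_Het X R d (c *\<^sub>R y) *v w = c\<^sup>2 *\<^sub>R (Omega_Het X R d y *v w)"
proof -
  have "diag (\<chi> i. d $ i * (u_hat X (c *\<^sub>R y) $ i)\<^sup>2) *v x
      = c\<^sup>2 *\<^sub>R (diag (\<chi> i. d $ i * (u_hat X y $ i)\<^sup>2) *v x)" for x
    by (simp add: diag_mult_vec linear_scale[OF linear_u_hat] vec_eq_iff power_mult_distrib mult_ac)
  then show ?thesis
    by (simp add: Omega_Het_def Psi_Het_def matrix_vector_mul_assoc[symmetric] matrix_vector_mult_scaleR)
qed

text \<open>The covariance estimator is quadratic in \<open>y\<close> and so is the square of the estimated contrast, so that the
factors cancel.\<close>
lemma T_Het_scale:
  fixes X :: "real^'k^'n"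
  assumes "c \<noteq> 0"
  shows "T_Het X R 0 d (c *\<^sub>R y) = T_Het X R 0 d y"
proof -
  have det: "det (Omega_Het X R d (c *\<^sub>R y)) \<noteq> 0 \<longleftrightarrow> det (Omega_Het X R d y) \<noteq> 0"
    using assms by (simp add: det_nz_iff_kernel Omega_Het_scale)
  show ?thesis
  proof (cases "det (Omega_Het X R d y) = 0")
    case True
    then show ?thesis using det by (simp add: T_Het_def)
  next
    case False
    define w where "w = matrix_inv (Omega_Het X R d y) *v (R *v beta_hat X y)"
    have w: "Omega_Het X R d y *v w = R *v beta_hat X y"
      using matrix_inv_solves(1)[OF False] by (simp add: w_def)
    have b: "R *v beta_hat X (c *\<^sub>R y) = c *\<^sub>R (R *v beta_hat X y)"
      by (simp add: linear_scale[OF linear_beta_hat] matrix_vector_mult_scaleR)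
    have "T_Het X R 0 d (c *\<^sub>R y) = (R *v beta_hat X (c *\<^sub>R y) - 0) \<bullet> ((1/c) *\<^sub>R w)"
      using False det assms by (intro T_Het_eqI)
        (auto simp: Omega_Het_scale matrix_vector_mult_scaleR w b power2_eq_square)
    also have "\<dots> = (R *v beta_hat X y - 0) \<bullet> w" using assms by (simp add: b)
    also have "\<dots> = T_Het X R 0 d y" by (rule T_Het_eqI[symmetric]) (use False w in auto)
    finally show ?thesis .
  qed
qed

text \<open>The inverse of a positive definite matrix is bounded below without computing it: expand
\<open>0 \<le> (w - s v) \<bullet> \<Omega> (w - s v)\<close> for the solution \<open>w\<close> of \<open>\<Omega> w = v\<close>. When \<open>\<Omega>\<close> tends to zero while
\<open>v\<close> stays away from zero, this forces the statistic above any given level.\<close>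
lemma T_Het_lower_bound:
  fixes X :: "real^'k^'n"
  assumes X: "rank X = CARD('k)" and d: "\<forall>i. d $ i > 0" and nz: "det (Omega_Het X R d y) \<noteq> 0"
  defines "v \<equiv> R *v beta_hat X y"
  shows "2 * s * (v \<bullet> v) - s\<^sup>2 * (v \<bullet> (Omega_Het X R d y *v v)) \<le> T_Het X R 0 d y"
proof -
  let ?O = "Omega_Het X R d y"
  define w where "w = matrix_inv ?O *v v"
  have w: "?O *v w = v" using matrix_inv_solves(1)[OF nz] by (simp add: w_def)
  have T: "T_Het X R 0 d y = v \<bullet> w"
    using T_Het_eqI[OF nz, of w 0] w by (simp add: v_def)
  have wv: "w \<bullet> (?O *v v) = v \<bullet> v" using Omega_Het_sym[OF X] w by metis
  have "0 \<le> (w - s *\<^sub>R v) \<bullet> (?O *v (w - s *\<^sub>R v))" by (rule Omega_Het_nonneg[OF X d])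
  also have "\<dots> = v \<bullet> w - 2 * s * (v \<bullet> v) + s\<^sup>2 * (v \<bullet> (?O *v v))"
    by (simp add: matrix_vector_mult_diff_distrib matrix_vector_mult_scaleR inner_diff_left inner_diff_right w wv
        power2_eq_square algebra_simps inner_commute[of w v])
  finally show ?thesis by (simp add: T)
qed

text \<open>The residuals and the estimated coefficients vary independently: adding a vector of the column space
of \<open>X\<close> keeps \<open>\<Omega>\<close> fixed and gives the contrast any prescribed value \<open>s v\<close>, for which the statistic grows
like \<open>s\<^sup>2\<close>.\<close>
lemma T_Het_attains_large_values:
  fixes X :: "real^'k^'n" and R :: "real^'k^'q"
  assumes X: "rank X = CARD('k)" and R: "rank R = CARD('q)" and d: "\<forall>i. d $ i > 0"
    and nz: "det (Omega_Het X R d y) \<noteq> 0"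
  obtains z where "det (Omega_Het X R d z) \<noteq> 0" and "T_Het X R 0 d z > C"
proof -
  let ?O = "Omega_Het X R d y"
  have surj: "surj ((*v) R)" using R full_rank_surjective by blast
  define v :: "real^'q" where "v = 1"
  define w where "w = matrix_inv ?O *v v"
  have w: "?O *v w = v" using matrix_inv_solves(1)[OF nz] by (simp add: w_def)
  have v0: "v \<noteq> 0" by (simp add: v_def)
  have "v \<bullet> w \<noteq> 0"
  proof
    assume "v \<bullet> w = 0"
    then have "w \<bullet> (?O *v w) = 0" by (simp add: w inner_commute)
    then have "a \<bullet> (?O *v w) = 0" for a
      using Omega_Het_null[OF X d] unfolding Omega_Het_form[OF X] by (intro sum.neutral ballI) force
    then have "v \<bullet> v = 0" using w by metis
    then show False using v0 by simp
  qed
  moreover have "v \<bullet> w \<ge> 0"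
    using Omega_Het_nonneg[OF X d, of w R y] w by (simp add: inner_commute)
  ultimately have pos: "v \<bullet> w > 0" by simp
  define s where "s = sqrt ((\<bar>C\<bar> + 1) / (v \<bullet> w))"
  have s: "s * s * (v \<bullet> w) = \<bar>C\<bar> + 1" using pos by (simp add: s_def)
  obtain b where b: "R *v b = s *\<^sub>R v - R *v beta_hat X y" using surj by (metis surjD)
  let ?z = "y + X *v b"
  have O: "Omega_Het X R d ?z = ?O"
    by (simp add: Omega_Het_def Psi_Het_def linear_add[OF linear_u_hat] u_hat_design[OF X])
  have v': "R *v beta_hat X ?z = s *\<^sub>R v"
    by (simp add: linear_add[OF linear_beta_hat] beta_hat_design[OF X] matrix_vector_right_distrib b)
  have "T_Het X R 0 d ?z = (s *\<^sub>R v) \<bullet> (s *\<^sub>R w)"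
    using T_Het_eqI[of X R d ?z "s *\<^sub>R w" 0] nz by (simp add: O v' matrix_vector_mult_scaleR w)
  also have "\<dots> = \<bar>C\<bar> + 1" using s by (simp add: mult.assoc)
  finally show ?thesis using that[of ?z] nz O by simp
qed

section \<open>Limits of probabilities and extremal values\<close>

lemma (in prob_space) prob_tendsto_1:
  assumes meas: "\<And>m. E m \<in> events" and ae: "AE x in M. \<forall>\<^sub>F m in sequentially. x \<in> E m"
  shows "(\<lambda>m. prob (E m)) \<longlonglongrightarrow> 1"
proof -
  have "(\<lambda>m. \<integral>x. indicator (E m) x \<partial>M) \<longlonglongrightarrow> (\<integral>x. 1 \<partial>M :: real)"
  proof (rule integral_dominated_convergence[where w="\<lambda>_. 1"])
    show "AE x in M. (\<lambda>m. indicator (E m) x :: real) \<longlonglongrightarrow> 1"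
      using ae
    proof eventually_elim
      fix x assume "\<forall>\<^sub>F m in sequentially. x \<in> E m"
      then show "(\<lambda>m. indicator (E m) x :: real) \<longlonglongrightarrow> 1"
        by (intro tendsto_eventually) (auto elim: eventually_mono)
    qed
  qed (use meas in \<open>auto simp: indicator_def\<close>)
  then show ?thesis using meas by (simp add: prob_space)
qed

lemma (in prob_space) prob_tendsto_0:
  assumes meas: "\<And>m. E m \<in> events" and ae: "AE x in M. \<forall>\<^sub>F m in sequentially. x \<notin> E m"
  shows "(\<lambda>m. prob (E m)) \<longlonglongrightarrow> 0"
proof -
  have "(\<lambda>m. prob (space M - E m)) \<longlonglongrightarrow> 1"
  proof (rule prob_tendsto_1)
    show "AE x in M. \<forall>\<^sub>F m in sequentially. x \<in> space M - E m"
      using ae AE_space by eventually_elim (auto elim: eventually_mono)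
  qed (use meas in auto)
  from tendsto_diff[OF tendsto_const[of 1] this] show ?thesis
    using meas by (simp add: prob_compl)
qed

lemma SUP_eq_1I:
  fixes f :: "'a \<Rightarrow> real"
  assumes "\<And>x. x \<in> A \<Longrightarrow> f x \<le> 1" and "\<And>m. s m \<in> A" and "(\<lambda>m::nat. f (s m)) \<longlonglongrightarrow> 1"
  shows "(SUP x\<in>A. f x) = 1"
proof (rule antisym)
  show "(SUP x\<in>A. f x) \<le> 1" using assms(1,2) by (intro cSUP_least) auto
  have "f (s m) \<le> (SUP x\<in>A. f x)" for m
    using assms(1,2) by (intro cSUP_upper) (auto intro: bdd_aboveI2[where M=1])
  then show "1 \<le> (SUP x\<in>A. f x)" by (intro LIMSEQ_le_const2[OF assms(3)]) auto
qed

text \<open>The bound by a separate null sequence \<open>g\<close> makes the rule applicable to nested infima, where \<open>f\<close> is itself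
an infimum.\<close>
lemma INF_eq_0I:
  fixes f :: "'a \<Rightarrow> real"
  assumes "\<And>x. x \<in> A \<Longrightarrow> 0 \<le> f x" and "\<And>m. s m \<in> A" and "\<And>m. f (s m) \<le> g m" and "(g::nat\<Rightarrow>real) \<longlonglongrightarrow> 0"
  shows "(INF x\<in>A. f x) = 0"
proof (rule antisym)
  show "0 \<le> (INF x\<in>A. f x)" using assms(1,2) by (intro cINF_greatest) auto
  have "(INF x\<in>A. f x) \<le> g m" for m
    using cINF_lower[of f A "s m"] assms(1,2,3) by (meson bdd_belowI2 order_trans)
  then show "(INF x\<in>A. f x) \<le> 0" by (intro LIMSEQ_le_const[OF assms(4)]) auto
qed

section \<open>Rejection probabilities in standard Gaussian coordinates\<close>

lemma AE_lborel_hyperplane: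
  fixes a :: "'a::euclidean_space"
  assumes "a \<noteq> 0"
  shows "AE x in lborel. a \<bullet> x \<noteq> 0"
proof -
  have "negligible {x. a \<bullet> x = 0}" using assms by (intro negligible_hyperplane) auto
  then have "{x. a \<bullet> x = 0} \<in> null_sets lebesgue" by (simp add: negligible_iff_null_sets)
  moreover have "{x. a \<bullet> x = 0} \<in> sets lborel" by simp
  ultimately have "{x. a \<bullet> x = 0} \<in> null_sets lborel" by (simp add: null_sets_completion_iff)
  then show ?thesis by (rule AE_I') auto
qed

lemma AE_std_gaussian_hyperplane:
  fixes a :: "real^'n"
  assumes "a \<noteq> 0"
  shows "AE x in std_gaussian. a \<bullet> x \<noteq> 0"
  unfolding gaussian_def using AE_lborel_hyperplane[OF assms]
  by (subst AE_density) auto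

lemma std_gaussian_open_pos:
  fixes U :: "(real^'n) set"
  assumes "open U" and "U \<noteq> {}"
  shows "measure std_gaussian U > 0"
proof (rule ccontr)
  interpret prob_space "std_gaussian :: (real^'n) measure" by (rule prob_space_std_gaussian)
  have [measurable]: "U \<in> sets borel" using assms by simp
  assume "\<not> measure std_gaussian U > 0"
  then have "measure std_gaussian U = 0" using measure_nonneg[of std_gaussian U] by linarith
  then have "emeasure std_gaussian U = 0" by (simp add: emeasure_eq_measure)
  then have "AE x in std_gaussian. x \<notin> U" by (intro AE_iff_null_sets[THEN iffD1]) auto
  then have "AE x in lborel. x \<notin> U"
    unfolding gaussian_def by (subst (asm) AE_density) auto
  then have "U \<in> null_sets lborel" by (subst AE_iff_null_sets) auto
  then have "negligible U"
    by (simp add: negligible_iff_null_sets null_sets_completion_iff)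
  then show False using assms open_not_negligible by blast
qed

text \<open>By invariance of the statistic, the variance \<open>s\<^sup>2\<close> enters only through the rescaled displacement \<open>x / s\<close>
of the mean from the null hypothesis. Moving the mean towards the null hypothesis and increasing the
variance thus have the same effect.\<close>
lemma measure_gaussian_diag:
  fixes X :: "real^'k^'n"
  assumes X: "rank X = CARD('k)" and \<mu>: "\<mu> \<in> \<MM>\<^sub>0 X R r" and s: "s > 0" and t: "\<And>i. \<tau> $ i \<noteq> 0"
  shows "measure (gaussian (x + \<mu>) (s\<^sup>2 *\<^sub>R diag (\<chi> i. (\<tau> $ i)\<^sup>2))) (W_Het X R r d C)
     = measure std_gaussian {z. C \<le> T_Het X R 0 d ((1/s) *\<^sub>R x + diag \<tau> *v z)}"
proof -
  have W: "W_Het X R r d C \<in> sets borel"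
    unfolding W_Het_def using borel_measurable_T_Het[OF X] by measurable
  define L where "L = diag (s *\<^sub>R \<tau>)"
  have Lz: "L *v z = s *\<^sub>R (diag \<tau> *v z)" for z
    by (simp add: L_def diag_mult_vec vec_eq_iff)
  have "det L = (\<Prod>i\<in>UNIV. s * \<tau> $ i)"
    unfolding L_def by (subst det_diagonal) (auto simp: diag_def)
  then have "invertible L" using s t by (simp add: invertible_det_nz)
  moreover have "s\<^sup>2 *\<^sub>R diag (\<chi> i. (\<tau> $ i)\<^sup>2) = L ** transpose L"
    by (simp add: L_def diag_def matrix_matrix_mult_def transpose_def vec_eq_iff power2_eq_square
        if_distrib[of "\<lambda>c. c * _"] if_distrib[of "\<lambda>c. _ * c"] mult_ac cong: if_cong)
  moreover have "(\<lambda>z. x + \<mu> + L *v z) \<in> borel_measurable borel" by measurable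
  ultimately have "measure (gaussian (x + \<mu>) (s\<^sup>2 *\<^sub>R diag (\<chi> i. (\<tau> $ i)\<^sup>2))) (W_Het X R r d C)
     = measure std_gaussian ((\<lambda>z. x + \<mu> + L *v z) -` W_Het X R r d C)"
    using W by (simp add: gaussian_affine measure_distr cong: measurable_cong_sets) (simp add: gaussian_def)
  also have "(\<lambda>z. x + \<mu> + L *v z) -` W_Het X R r d C = {z. C \<le> T_Het X R 0 d ((1/s) *\<^sub>R x + diag \<tau> *v z)}"
  proof -
    have "T_Het X R r d (x + \<mu> + L *v z) = T_Het X R 0 d ((1/s) *\<^sub>R x + diag \<tau> *v z)" for z
    proof -
      have "x + \<mu> + L *v z = s *\<^sub>R ((1/s) *\<^sub>R x + diag \<tau> *v z) + \<mu>"
        using s by (simp add: Lz scaleR_add_right)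
      then have "T_Het X R r d (x + \<mu> + L *v z) = T_Het X R r d (s *\<^sub>R ((1/s) *\<^sub>R x + diag \<tau> *v z) + \<mu>)"
        by (simp only:)
      also have "\<dots> = T_Het X R 0 d (s *\<^sub>R ((1/s) *\<^sub>R x + diag \<tau> *v z))"
        by (rule T_Het_shift[OF X \<mu>])
      also have "\<dots> = T_Het X R 0 d ((1/s) *\<^sub>R x + diag \<tau> *v z)"
        using s by (intro T_Het_scale) simp
      finally show ?thesis .
    qed
    then show ?thesis by (auto simp: W_Het_def)
  qed
  finally show ?thesis .
qed

section \<open>Covariances concentrating on one coordinate\<close>

text \<open>A sequence of unit vectors with positive coordinates that tends to the basis vector \<open>e\<^sub>i\<close>. The
diagonal covariance with the squares of its entries is heteroskedastic in the normalised sense and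
degenerates, in the limit, to a Gaussian concentrated on the \<open>i\<close>-th coordinate axis.\<close>
definition spike :: "'n \<Rightarrow> nat \<Rightarrow> real^'n" where
  "spike i m = (1 / norm (axis i 1 + (1 / real (Suc m)) *\<^sub>R (1 :: real^'n))) *\<^sub>R (axis i 1 + (1 / real (Suc m)) *\<^sub>R 1)"

lemma spike_pos: "spike i m $ j > 0"
proof -
  let ?w = "axis i 1 + (1 / real (Suc m)) *\<^sub>R 1 :: real^'a"
  have p: "?w $ j > 0" for j by (auto simp: axis_def intro!: add_pos_pos)
  then have "?w \<noteq> 0" by (metis less_irrefl zero_index)
  then show ?thesis using p[of j] unfolding spike_def by simp
qed

lemma spike_norm: "(\<Sum>j\<in>UNIV. (spike i m $ j)\<^sup>2) = 1"
proof -
  have "spike i m \<noteq> 0" using spike_pos by (metis less_irrefl zero_index)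
  then have "norm (spike i m) = 1" unfolding spike_def by auto
  then have "spike i m \<bullet> spike i m = 1" by (simp add: dot_square_norm)
  then show ?thesis by (simp add: inner_vec_def power2_eq_square)
qed

lemma spike_tendsto: "spike i \<longlonglongrightarrow> axis i 1"
proof -
  have l: "(\<lambda>m. axis i 1 + (1 / real (Suc m)) *\<^sub>R (1 :: real^'a)) \<longlonglongrightarrow> axis i 1 + 0 *\<^sub>R 1"
    by (intro tendsto_add tendsto_scaleR tendsto_const) (rule lim_1_over_n[THEN LIMSEQ_Suc])
  have "(\<lambda>m. (1 / norm (axis i 1 + (1 / real (Suc m)) *\<^sub>R (1 :: real^'a))) *\<^sub>R (axis i 1 + (1 / real (Suc m)) *\<^sub>R (1 :: real^'a)))
     \<longlonglongrightarrow> (1 / norm (axis i 1 + 0 *\<^sub>R (1 :: real^'a))) *\<^sub>R (axis i 1 + 0 *\<^sub>R 1)"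
    by (rule tendsto_scaleR[OF tendsto_divide[OF tendsto_const tendsto_norm[OF l]] l]) simp
  then show ?thesis by (simp add: spike_def[abs_def])
qed

definition spike_cov :: "'n \<Rightarrow> nat \<Rightarrow> real^'n^'n" where
  "spike_cov i m = diag (\<chi> j. (spike i m $ j)\<^sup>2)"

lemma spike_cov_in_Het: "spike_cov i m \<in> \<CC>_Het"
  unfolding \<CC>_Het_def spike_cov_def using spike_norm[of i m] spike_pos[of i m]
  by (auto intro!: exI[of _ "spike i m"] simp: less_imp_neq[symmetric])

lemma tendsto_spike_mult:
  assumes "a \<longlonglongrightarrow> 0"
  shows "(\<lambda>m. a m + diag (spike i m) *v z) \<longlonglongrightarrow> (z $ i) *\<^sub>R axis i 1"
proof -
  have "(\<lambda>m. a m + (\<chi> j. spike i m $ j * z $ j)) \<longlonglongrightarrow> 0 + (\<chi> j. axis i 1 $ j * z $ j)"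
    by (intro tendsto_add assms tendsto_vec_lambda tendsto_mult tendsto_const tendsto_vec_nth spike_tendsto)
  moreover have "0 + (\<chi> j. axis i 1 $ j * z $ j) = (z $ i) *\<^sub>R axis i 1"
    by (simp add: vec_eq_iff axis_def)
  ultimately show ?thesis by (simp add: diag_mult_vec)
qed

lemma AE_std_gaussian_component: "AE z in std_gaussian. (z :: real^'n) $ i \<noteq> 0"
  using AE_std_gaussian_hyperplane[of "axis i 1 :: real^'n"] by (simp add: inner_axis')

section \<open>Limits of the rejection probability\<close>
context
  fixes X :: "real^'k^'n" and R :: "real^'k^'q" and d :: "real^'n" and i :: 'n
  assumes X: "rank X = CARD('k)" and d: "\<forall>i. d $ i > 0"
begin

lemma rejection_event_measurable:
  "{z. C \<le> T_Het X R 0 d (a + diag \<tau> *v z)} \<in> sets std_gaussian"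
  using borel_measurable_T_Het[OF X] by measurable

text \<open>The observation tends to \<open>z\<^sub>i e\<^sub>i\<close>, where the statistic is continuous and, by scale invariance, has
the same value as at \<open>e\<^sub>i\<close>.\<close>
lemma tendsto_statistic_spike:
  assumes nz: "det (Omega_Het X R d (axis i 1)) \<noteq> 0" and a: "a \<longlonglongrightarrow> 0" and z: "z $ i \<noteq> 0"
  shows "(\<lambda>m. T_Het X R 0 d (a m + diag (spike i m) *v z)) \<longlonglongrightarrow> T_Het X R 0 d (axis i 1)"
proof -
  have "det (Omega_Het X R d ((z $ i) *\<^sub>R axis i 1)) \<noteq> 0"
    using nz z by (simp add: det_nz_iff_kernel Omega_Het_scale)
  from tendsto_T_Het[OF X tendsto_spike_mult[OF a] this, of 0]
  show ?thesis by (simp add: T_Het_scale[OF z])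
qed

lemma rejection_prob_tendsto_1:
  assumes nz: "det (Omega_Het X R d (axis i 1)) \<noteq> 0" and a: "a \<longlonglongrightarrow> 0" and T: "T_Het X R 0 d (axis i 1) > C"
  shows "(\<lambda>m. measure std_gaussian {z. C \<le> T_Het X R 0 d (a m + diag (spike i m) *v z)}) \<longlonglongrightarrow> 1"
proof (rule prob_space.prob_tendsto_1[OF prob_space_std_gaussian])
  show "AE z in std_gaussian. \<forall>\<^sub>F m in sequentially. z \<in> {z. C \<le> T_Het X R 0 d (a m + diag (spike i m) *v z)}"
    using AE_std_gaussian_component[of i]
  proof eventually_elim
    case (elim z)
    from order_tendstoD(1)[OF tendsto_statistic_spike[OF nz a elim] T]
    show ?case by eventually_elim simp
  qed
qed (rule rejection_event_measurable)

lemma rejection_prob_tendsto_0: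
  assumes nz: "det (Omega_Het X R d (axis i 1)) \<noteq> 0" and a: "a \<longlonglongrightarrow> 0" and T: "T_Het X R 0 d (axis i 1) < C"
  shows "(\<lambda>m. measure std_gaussian {z. C \<le> T_Het X R 0 d (a m + diag (spike i m) *v z)}) \<longlonglongrightarrow> 0"
proof (rule prob_space.prob_tendsto_0[OF prob_space_std_gaussian])
  show "AE z in std_gaussian. \<forall>\<^sub>F m in sequentially. z \<notin> {z. C \<le> T_Het X R 0 d (a m + diag (spike i m) *v z)}"
    using AE_std_gaussian_component[of i]
  proof eventually_elim
    case (elim z)
    from order_tendstoD(2)[OF tendsto_statistic_spike[OF nz a elim] T]
    show ?case by eventually_elim simp
  qed
qed (rule rejection_event_measurable)

text \<open>Each residual that is not identically zero vanishes only on a hyperplane, and by the rank condition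
it suffices for regularity that none of these residuals vanishes.\<close>
lemma AE_Omega_Het_nonsingular:
  assumes rc: "rank_condition X R" and t: "\<And>j. \<tau> $ j \<noteq> 0"
  shows "AE z in std_gaussian. det (Omega_Het X R d (diag \<tau> *v z)) \<noteq> 0"
proof -
  have "AE z in std_gaussian. axis j 1 \<notin> span (columns X) \<longrightarrow> u_hat X (diag \<tau> *v z) $ j \<noteq> 0" for j
  proof (cases "axis j 1 \<in> span (columns X)")
    case False
    let ?w = "u_hat X (axis j 1)"
    have "?w \<noteq> 0" using False u_hat_axis_eq_0_iff[OF X] by blast
    then obtain k where "?w $ k \<noteq> 0" by (auto simp: vec_eq_iff)
    then have "(diag \<tau> *v ?w) $ k \<noteq> 0" using t by (simp add: diag_mult_vec)
    then have "diag \<tau> *v ?w \<noteq> 0" by auto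
    moreover have "(diag \<tau> *v ?w) \<bullet> z = u_hat X (diag \<tau> *v z) $ j" for z
    proof -
      have "u_hat X (diag \<tau> *v z) $ j = axis j 1 \<bullet> u_hat X (diag \<tau> *v z)" by (simp add: inner_axis')
      also have "\<dots> = ?w \<bullet> (diag \<tau> *v z)" by (rule inner_u_hat[OF X])
      also have "\<dots> = (diag \<tau> *v ?w) \<bullet> z" by (simp add: diag_mult_vec inner_vec_def mult_ac)
      finally show ?thesis ..
    qed
    ultimately show ?thesis using AE_std_gaussian_hyperplane[of "diag \<tau> *v ?w"] by simp
  qed simp
  then have "AE z in std_gaussian. \<forall>j. axis j 1 \<notin> span (columns X) \<longrightarrow> u_hat X (diag \<tau> *v z) $ j \<noteq> 0"
    unfolding AE_all_countable by blast
  then show ?thesis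
    by eventually_elim (rule Omega_Het_nonsingular_of_residuals[OF X d rc], blast)
qed

text \<open>Here the covariance estimator vanishes at \<open>e\<^sub>i\<close> while the estimated contrast does not, so the
statistic tends to infinity along the sequence, provided that the estimator is regular at almost every
point; the default value \<open>0\<close> of the statistic would otherwise lead to acceptance.\<close>
lemma rejection_prob_tendsto_1_degenerate:
  assumes rc: "rank_condition X R" and B: "B_Het X R (axis i 1) = 0" and nz: "R *v beta_hat X (axis i 1) \<noteq> 0"
    and C: "C > 0"
  shows "(\<lambda>m. measure std_gaussian {z. C \<le> T_Het X R 0 d (0 + diag (spike i m) *v z)}) \<longlonglongrightarrow> 1"
proof (rule prob_space.prob_tendsto_1[OF prob_space_std_gaussian])
  have "AE z in std_gaussian. \<forall>m. det (Omega_Het X R d (diag (spike i m) *v z)) \<noteq> 0"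
    unfolding AE_all_countable
    using AE_Omega_Het_nonsingular[OF rc] spike_pos by (metis less_irrefl)
  then show "AE z in std_gaussian. \<forall>\<^sub>F m in sequentially. z \<in> {z. C \<le> T_Het X R 0 d (0 + diag (spike i m) *v z)}"
    using AE_std_gaussian_component[of i]
  proof eventually_elim
    case (elim z)
    let ?y = "\<lambda>m. diag (spike i m) *v z" and ?l = "(z $ i) *\<^sub>R axis i 1"
    define v where "v = (\<lambda>m. R *v beta_hat X (?y m))"
    define v0 where "v0 = R *v beta_hat X ?l"
    have y: "?y \<longlonglongrightarrow> ?l" using tendsto_spike_mult[of "\<lambda>_. 0" i z] by simp
    have "v0 \<noteq> 0" using nz elim(2)
      by (simp add: v0_def linear_scale[OF linear_beta_hat] matrix_vector_mult_scaleR)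
    have v: "v \<longlonglongrightarrow> v0" unfolding v_def v0_def
      by (rule tendsto_linear[OF matrix_vector_mul_linear tendsto_linear[OF linear_beta_hat y]])
    have O0: "Omega_Het X R d ?l *v w = 0" for w
      by (simp add: Omega_Het_scale Omega_Het_eq_0[OF X B])
    have O: "(\<lambda>m. Omega_Het X R d (?y m) *v v m) \<longlonglongrightarrow> 0"
    proof -
      have "(\<lambda>m. \<Sum>j\<in>UNIV. Omega_Het X R d (?y m) $ l $ j * v m $ j) \<longlonglongrightarrow> (\<Sum>j\<in>UNIV. Omega_Het X R d ?l $ l $ j * v0 $ j)" for l
        by (intro tendsto_sum tendsto_mult tendsto_vec_nth tendsto_Omega_Het[OF X y] v)
      then have "(\<lambda>m. Omega_Het X R d (?y m) *v v m) \<longlonglongrightarrow> Omega_Het X R d ?l *v v0"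
        unfolding matrix_vector_mult_def by (rule tendsto_vec_lambda)
      then show ?thesis by (simp add: O0)
    qed
    \<comment> \<open>With this choice the lower bound tends to \<open>2 * C\<close>.\<close>
    define s where "s = C / (v0 \<bullet> v0)"
    have "(\<lambda>m. 2 * s * (v m \<bullet> v m) - s\<^sup>2 * (v m \<bullet> (Omega_Het X R d (?y m) *v v m)))
        \<longlonglongrightarrow> 2 * s * (v0 \<bullet> v0) - s\<^sup>2 * (v0 \<bullet> 0)"
      by (intro tendsto_diff tendsto_mult tendsto_const tendsto_inner v O)
    moreover have "2 * s * (v0 \<bullet> v0) - s\<^sup>2 * (v0 \<bullet> 0) > C"
      using \<open>v0 \<noteq> 0\<close> C by (simp add: s_def)
    ultimately have "\<forall>\<^sub>F m in sequentially. C < 2 * s * (v m \<bullet> v m) - s\<^sup>2 * (v m \<bullet> (Omega_Het X R d (?y m) *v v m))"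
      by (rule order_tendstoD(1))
    moreover have "2 * s * (v m \<bullet> v m) - s\<^sup>2 * (v m \<bullet> (Omega_Het X R d (?y m) *v v m)) \<le> T_Het X R 0 d (?y m)" for m
      unfolding v_def using elim(1) by (intro T_Het_lower_bound[OF X d]) simp
    ultimately have "\<forall>\<^sub>F m in sequentially. C \<le> T_Het X R 0 d (?y m)"
      by (elim eventually_mono) (meson less_imp_le less_le_trans)
    then show ?case by simp
  qed
qed (rule rejection_event_measurable)

end

section \<open>Size, power and bias\<close>

lemma measure_gaussian_le_1:
  assumes "covariance_model \<CC>" and "\<Sigma> \<in> \<CC>" and "\<sigma>2 > 0"
  shows "measure (gaussian \<mu> (\<sigma>2 *\<^sub>R \<Sigma>)) W \<le> 1"
proof -
  have "sym_pos_def \<Sigma>" using assms by (auto simp: covariance_model_def)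
  then have "sym_pos_def (\<sigma>2 *\<^sub>R \<Sigma>)"
    using assms(3) by (auto simp: sym_pos_def_def transpose_def vec_eq_iff scaleR_matrix_vector_assoc[symmetric])
  then show ?thesis by (intro prob_space.prob_le_1 prob_space_gaussian)
qed

lemma \<MM>\<^sub>0_nonempty:
  fixes R :: "real^'k^'q"
  assumes "rank R = CARD('q)"
  shows "\<MM>\<^sub>0 X R r \<noteq> {}"
proof -
  have "surj ((*v) R)" using assms full_rank_surjective by blast
  then obtain b where "R *v b = r" by (metis surjD)
  then show ?thesis by (auto simp: \<MM>\<^sub>0_def)
qed

lemma measure_gaussian_spike:
  fixes X :: "real^'k^'n"
  assumes X: "rank X = CARD('k)" and \<mu>: "\<mu> \<in> \<MM>\<^sub>0 X R r" and s: "\<sigma>2 > 0"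
  shows "measure (gaussian (x + \<mu>) (\<sigma>2 *\<^sub>R spike_cov i m)) (W_Het X R r d C)
     = measure std_gaussian {z. C \<le> T_Het X R 0 d ((1 / sqrt \<sigma>2) *\<^sub>R x + diag (spike i m) *v z)}"
  using measure_gaussian_diag[OF X \<mu>, of "sqrt \<sigma>2" "spike i m" x d C] s spike_pos[of i m]
  by (simp add: spike_cov_def less_imp_neq[symmetric])

text \<open>The summand \<open>0\<close> in the limit is the displacement of the mean, which vanishes under the null hypothesis.\<close>
lemma null_rejection_SUP_eq_1:
  fixes X :: "real^'k^'n" and R :: "real^'k^'q"
  assumes X: "rank X = CARD('k)" and R: "rank R = CARD('q)"
    and cm: "covariance_model \<CC>" and het: "\<CC>_Het \<subseteq> \<CC>"
    and lim: "(\<lambda>m. measure std_gaussian {z. C \<le> T_Het X R 0 d (0 + diag (spike i m) *v z)}) \<longlonglongrightarrow> 1"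
  shows "(\<forall>\<mu>0\<in>\<MM>\<^sub>0 X R r. \<forall>\<sigma>2>0.
          (SUP \<Sigma>\<in>\<CC>. measure (gaussian \<mu>0 (\<sigma>2 *\<^sub>R \<Sigma>)) (W_Het X R r d C)) = 1) \<and>
       size_of_test X R r \<CC> (W_Het X R r d C) = 1"
proof (intro conjI ballI allI impI)
  have mem: "spike_cov i m \<in> \<CC>" for m using spike_cov_in_Het het by blast
  have eq: "measure (gaussian \<mu> (\<sigma>2 *\<^sub>R spike_cov i m)) (W_Het X R r d C)
     = measure std_gaussian {z. C \<le> T_Het X R 0 d (0 + diag (spike i m) *v z)}"
    if "\<mu> \<in> \<MM>\<^sub>0 X R r" "\<sigma>2 > 0" for \<mu> \<sigma>2 m
    using measure_gaussian_spike[OF X that, of 0 i m d C] by simp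
  {
    fix \<mu>0 and \<sigma>2 :: real assume "\<mu>0 \<in> \<MM>\<^sub>0 X R r" "\<sigma>2 > 0"
    then show "(SUP \<Sigma>\<in>\<CC>. measure (gaussian \<mu>0 (\<sigma>2 *\<^sub>R \<Sigma>)) (W_Het X R r d C)) = 1"
      using lim by (intro SUP_eq_1I[where s="spike_cov i"] measure_gaussian_le_1[OF cm] mem) (simp_all add: eq)
  }
  obtain \<mu> where \<mu>: "\<mu> \<in> \<MM>\<^sub>0 X R r" using \<MM>\<^sub>0_nonempty[OF R] by blast
  show "size_of_test X R r \<CC> (W_Het X R r d C) = 1"
    unfolding size_of_test_def
    using lim \<mu> mem eq[OF \<mu>, of 1]
    by (intro SUP_eq_1I[where s="\<lambda>m. (\<mu>, 1, spike_cov i m)"])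
       (auto intro: measure_gaussian_le_1[OF cm])
qed

text \<open>The statistic exceeds the critical value on a nonempty open set, to which every nondegenerate Gaussian
measure gives positive probability.\<close>
lemma size_of_test_pos:
  fixes X :: "real^'k^'n" and R :: "real^'k^'q"
  assumes X: "rank X = CARD('k)" and R: "rank R = CARD('q)" and d: "\<forall>i. d $ i > 0"
    and cm: "covariance_model \<CC>" and het: "\<CC>_Het \<subseteq> \<CC>"
    and nz: "det (Omega_Het X R d y) \<noteq> 0"
  shows "size_of_test X R r \<CC> (W_Het X R r d C) > 0"
proof -
  obtain \<mu> where \<mu>: "\<mu> \<in> \<MM>\<^sub>0 X R r" using \<MM>\<^sub>0_nonempty[OF R] by blast
  obtain y0 where y0: "det (Omega_Het X R d y0) \<noteq> 0" "T_Het X R 0 d y0 > C"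
    using T_Het_attains_large_values[OF X R d nz] .
  \<comment> \<open>Any coordinate serves: only one element of the covariance model is needed.\<close>
  let ?i = "undefined :: 'n"
  let ?\<tau> = "spike ?i 0"
  let ?S = "{z. C \<le> T_Het X R 0 d (0 + diag ?\<tau> *v z)}"
  have \<tau>: "?\<tau> $ j \<noteq> 0" for j using spike_pos[of ?i 0 j] by simp
  have "\<forall>\<^sub>F y in nhds y0. T_Het X R 0 d y > C"
    by (rule order_tendstoD(1)[OF tendsto_T_Het[OF X _ y0(1)] y0(2)]) (rule filterlim_ident)
  then obtain U where U: "open U" "y0 \<in> U" "\<And>y. y \<in> U \<Longrightarrow> T_Het X R 0 d y > C"
    unfolding eventually_nhds by blast
  let ?V = "(\<lambda>z. diag ?\<tau> *v z) -` U"
  have "open ?V"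
    using U(1) by (intro open_vimage linear_continuous_on) (simp_all flip: linear_conv_bounded_linear)
  moreover have "(\<chi> j. y0 $ j / ?\<tau> $ j) \<in> ?V"
    using U(2) \<tau> by (simp add: diag_mult_vec)
  ultimately have "0 < measure std_gaussian ?V" by (intro std_gaussian_open_pos) auto
  also have "\<dots> \<le> measure std_gaussian ?S"
  proof (rule finite_measure.finite_measure_mono)
    show "finite_measure (std_gaussian :: (real^'n) measure)"
      using prob_space_std_gaussian by (rule prob_space.finite_measure)
    show "?V \<subseteq> ?S" using U(3) by (auto intro: less_imp_le)
  qed (rule rejection_event_measurable[OF X d])
  also have "\<dots> = measure (gaussian \<mu> (1 *\<^sub>R spike_cov ?i 0)) (W_Het X R r d C)"
    using measure_gaussian_spike[OF X \<mu>, of 1 0 ?i 0 d C] by simp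
  also have "\<dots> \<le> size_of_test X R r \<CC> (W_Het X R r d C)"
    unfolding size_of_test_def
    using \<mu> spike_cov_in_Het[of ?i 0] het
    by (intro cSUP_upper2[where x="(\<mu>, 1, spike_cov ?i 0)"] bdd_aboveI2[where M=1])
       (auto intro: measure_gaussian_le_1[OF cm])
  finally show ?thesis .
qed

lemma \<MM>\<^sub>1_displacement:
  fixes X :: "real^'k^'n" and R :: "real^'k^'q"
  assumes X: "rank X = CARD('k)" and \<mu>: "\<mu> \<in> \<MM>\<^sub>0 X R r" and b: "R *v b \<noteq> 0" and c: "c \<noteq> 0"
  shows "c *\<^sub>R (X *v b) + \<mu> \<in> \<MM>\<^sub>1 X R r"
proof -
  obtain b0 where b0: "\<mu> = X *v b0" "R *v b0 = r" using \<mu> by (auto simp: \<MM>\<^sub>0_def)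
  have e: "c *\<^sub>R (X *v b) + \<mu> = X *v (c *\<^sub>R b + b0)"
    by (simp add: b0 matrix_vector_right_distrib matrix_vector_mult_scaleR)
  have "X *v (c *\<^sub>R b + b0) \<notin> \<MM>\<^sub>0 X R r"
  proof
    assume "X *v (c *\<^sub>R b + b0) \<in> \<MM>\<^sub>0 X R r"
    then obtain b1 where b1: "X *v (c *\<^sub>R b + b0) = X *v b1" "R *v b1 = r" by (auto simp: \<MM>\<^sub>0_def)
    then have "c *\<^sub>R b + b0 = b1" using X by (simp add: full_rank_injective inj_def)
    then have "c *\<^sub>R (R *v b) + r = r"
      using b1(2) b0(2) by (auto simp: matrix_vector_right_distrib matrix_vector_mult_scaleR)
    then show False using b c by simp
  qed
  then show ?thesis unfolding \<MM>\<^sub>1_def e by (simp add: matrix_vector_mult_in_columnspace)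
qed

text \<open>All four infima are approached along the same degenerating covariances; the mean is either a point of
the null hypothesis, or approaches one at fixed variance, or is fixed while the variance tends to
infinity. In each case the displacement rescaled by the standard deviation tends to zero.\<close>
lemma rejection_INF_eq_0:
  fixes X :: "real^'k^'n" and R :: "real^'k^'q" and r :: "real^'q" and \<CC> :: "(real^'n^'n) set"
  assumes X: "rank X = CARD('k)" and R: "rank R = CARD('q)"
    and d: "\<forall>i. d $ i > 0" and het: "\<CC>_Het \<subseteq> \<CC>"
    and nz: "det (Omega_Het X R d (axis i 1)) \<noteq> 0" and lt: "T_Het X R 0 d (axis i 1) < C"
  defines "P \<equiv> \<lambda>\<mu> \<sigma>2 \<Sigma>. measure (gaussian \<mu> (\<sigma>2 *\<^sub>R \<Sigma>)) (W_Het X R r d C)"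
  shows "\<forall>\<mu>0\<in>\<MM>\<^sub>0 X R r. \<forall>\<sigma>2>0. (INF \<Sigma>\<in>\<CC>. P \<mu>0 \<sigma>2 \<Sigma>) = 0" (is ?A)
    and "\<forall>\<sigma>2>0. (INF \<mu>1\<in>\<MM>\<^sub>1 X R r. INF \<Sigma>\<in>\<CC>. P \<mu>1 \<sigma>2 \<Sigma>) = 0" (is ?B)
    and "\<forall>\<mu>1\<in>\<MM>\<^sub>1 X R r. (INF \<sigma>2\<in>{0<..}. INF \<Sigma>\<in>\<CC>. P \<mu>1 \<sigma>2 \<Sigma>) = 0" (is ?D)
    and "infimal_power X R r \<CC> (W_Het X R r d C) = 0" (is ?E)
proof -
  have mem: "spike_cov i m \<in> \<CC>" for m using spike_cov_in_Het het by blast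
  have nonneg: "0 \<le> P \<mu> \<sigma>2 \<Sigma>" for \<mu> \<sigma>2 \<Sigma> by (simp add: P_def)
  have inner_nonneg: "0 \<le> (INF \<Sigma>\<in>\<CC>. P \<mu> \<sigma>2 \<Sigma>)" for \<mu> \<sigma>2
    using mem nonneg by (intro cINF_greatest) auto
  have inner_le: "(INF \<Sigma>\<in>\<CC>. P \<mu> \<sigma>2 \<Sigma>) \<le> P \<mu> \<sigma>2 (spike_cov i m)" for \<mu> \<sigma>2 m
    using mem nonneg by (intro cINF_lower bdd_belowI2[where m=0]) auto
  obtain \<mu> where \<mu>: "\<mu> \<in> \<MM>\<^sub>0 X R r" using \<MM>\<^sub>0_nonempty[OF R] by blast
  have "surj ((*v) R)" using R full_rank_surjective by blast
  then obtain b where "R *v b = 1" by (metis surjD)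
  then have b: "R *v b \<noteq> 0" by simp
  have P_lim: "(\<lambda>m. P (x m + \<mu>0) (\<sigma>2 m) (spike_cov i m)) \<longlonglongrightarrow> 0"
    if "\<mu>0 \<in> \<MM>\<^sub>0 X R r" "\<And>m. \<sigma>2 m > 0" "(\<lambda>m. (1 / sqrt (\<sigma>2 m)) *\<^sub>R x m) \<longlonglongrightarrow> 0" for x \<mu>0 \<sigma>2
    using rejection_prob_tendsto_0[OF X d nz that(3) lt] that(1,2) by (simp add: P_def measure_gaussian_spike[OF X])
  have null: "(\<lambda>m. 1 / real (Suc m)) \<longlonglongrightarrow> 0" by (rule lim_1_over_n[THEN LIMSEQ_Suc])
  let ?x = "\<lambda>m. (1 / real (Suc m)) *\<^sub>R (X *v b)"
  have x0: "(\<lambda>m. (1 / sqrt \<sigma>2) *\<^sub>R ?x m) \<longlonglongrightarrow> 0" for \<sigma>2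
    using tendsto_scaleR[OF tendsto_const tendsto_scaleR[OF null tendsto_const], of "1 / sqrt \<sigma>2" "X *v b"] by simp
  have M1: "?x m + \<mu> \<in> \<MM>\<^sub>1 X R r" for m by (rule \<MM>\<^sub>1_displacement[OF X \<mu> b]) simp
  show ?A
  proof (intro ballI allI impI)
    fix \<mu>0 and \<sigma>2 :: real assume "\<mu>0 \<in> \<MM>\<^sub>0 X R r" "\<sigma>2 > 0"
    then have "(\<lambda>m. P \<mu>0 \<sigma>2 (spike_cov i m)) \<longlonglongrightarrow> 0"
      using P_lim[of \<mu>0 "\<lambda>_. \<sigma>2" "\<lambda>_. 0"] by simp
    then show "(INF \<Sigma>\<in>\<CC>. P \<mu>0 \<sigma>2 \<Sigma>) = 0"
      by (intro INF_eq_0I[where s="spike_cov i" and g="\<lambda>m. P \<mu>0 \<sigma>2 (spike_cov i m)"] nonneg mem) simp_all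
  qed
  show ?B
  proof (intro allI impI)
    fix \<sigma>2 :: real assume "\<sigma>2 > 0"
    then show "(INF \<mu>1\<in>\<MM>\<^sub>1 X R r. INF \<Sigma>\<in>\<CC>. P \<mu>1 \<sigma>2 \<Sigma>) = 0"
      using P_lim[OF \<mu>, of "\<lambda>_. \<sigma>2", OF _ x0]
      by (intro INF_eq_0I[where s="\<lambda>m. ?x m + \<mu>" and g="\<lambda>m. P (?x m + \<mu>) \<sigma>2 (spike_cov i m)"]
          inner_nonneg M1 inner_le)
  qed
  show ?D
  proof
    fix \<mu>1 assume "\<mu>1 \<in> \<MM>\<^sub>1 X R r"
    let ?v = "\<lambda>m. (real (Suc m))\<^sup>2"
    have "(\<lambda>m. (1 / sqrt (?v m)) *\<^sub>R (\<mu>1 - \<mu>)) \<longlonglongrightarrow> 0"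
      using tendsto_scaleR[OF null tendsto_const, of "\<mu>1 - \<mu>"] by (simp del: of_nat_Suc)
    from P_lim[OF \<mu> _ this] have "(\<lambda>m. P \<mu>1 (?v m) (spike_cov i m)) \<longlonglongrightarrow> 0" by simp
    then show "(INF \<sigma>2\<in>{0<..}. INF \<Sigma>\<in>\<CC>. P \<mu>1 \<sigma>2 \<Sigma>) = 0"
      by (intro INF_eq_0I[where s="?v" and g="\<lambda>m. P \<mu>1 (?v m) (spike_cov i m)"] inner_nonneg inner_le) simp_all
  qed
  show ?E
    unfolding infimal_power_def
  proof (rule INF_eq_0I[where s="\<lambda>m. (?x m + \<mu>, 1, spike_cov i m)"])
    show "(\<lambda>m. P (?x m + \<mu>) 1 (spike_cov i m)) \<longlonglongrightarrow> 0"
      using P_lim[OF \<mu>, of "\<lambda>_. 1", OF _ x0] by simp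
  qed (use M1 mem in \<open>auto simp: P_def\<close>)
qed

theorem theorem4p2:
  fixes X :: "real ^ 'k ^ 'n"
    and R :: "real ^ 'k ^ 'q"
    and r :: "real ^ 'q"
    and \<CC> :: "(real ^ 'n ^ 'n) set"
    and d :: "real ^ 'n"
    and C :: real
  assumes "CARD('k) < CARD('n)"
    and "rank X = CARD('k)"
    and "rank R = CARD('q)"
    and "covariance_model \<CC>"
    and "\<forall>i. d $ i > 0"
    and "\<CC>_Het \<subseteq> \<CC>"
    and "rank_condition X R"
    and "0 < C"
  shows
    "(\<forall>i. rank (B_Het X R (axis i 1)) = CARD('q) \<and>
          (\<exists>\<mu>\<in>\<MM>\<^sub>0 X R r. T_Het X R r d (axis i 1 + \<mu>) > C) \<longrightarrow>
       (\<forall>\<mu>\<in>\<MM>\<^sub>0 X R r. T_Het X R r d (axis i 1 + \<mu>) > C) \<and>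
       (\<forall>\<mu>0\<in>\<MM>\<^sub>0 X R r. \<forall>\<sigma>2>0.
          (SUP \<Sigma>\<in>\<CC>. measure (gaussian \<mu>0 (\<sigma>2 *\<^sub>R \<Sigma>)) (W_Het X R r d C)) = 1) \<and>
       size_of_test X R r \<CC> (W_Het X R r d C) = 1)
   \<and>
     (\<forall>i. rank (B_Het X R (axis i 1)) = CARD('q) \<and>
          (\<exists>\<mu>\<in>\<MM>\<^sub>0 X R r. T_Het X R r d (axis i 1 + \<mu>) < C) \<longrightarrow>
       (\<forall>\<mu>\<in>\<MM>\<^sub>0 X R r. T_Het X R r d (axis i 1 + \<mu>) < C) \<and>
       (\<forall>\<mu>0\<in>\<MM>\<^sub>0 X R r. \<forall>\<sigma>2>0.
          (INF \<Sigma>\<in>\<CC>. measure (gaussian \<mu>0 (\<sigma>2 *\<^sub>R \<Sigma>)) (W_Het X R r d C)) = 0) \<and>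
       (\<forall>\<sigma>2>0.
          (INF \<mu>1\<in>\<MM>\<^sub>1 X R r. INF \<Sigma>\<in>\<CC>.
             measure (gaussian \<mu>1 (\<sigma>2 *\<^sub>R \<Sigma>)) (W_Het X R r d C)) = 0) \<and>
       biased_test X R r \<CC> (W_Het X R r d C) \<and>
       (\<forall>\<mu>1\<in>\<MM>\<^sub>1 X R r.
          (INF \<sigma>2\<in>{0<..}. INF \<Sigma>\<in>\<CC>.
             measure (gaussian \<mu>1 (\<sigma>2 *\<^sub>R \<Sigma>)) (W_Het X R r d C)) = 0) \<and>
       infimal_power X R r \<CC> (W_Het X R r d C) = 0)
   \<and>
     (\<forall>i. B_Het X R (axis i 1) = 0 \<and> R *v beta_hat X (axis i 1) \<noteq> 0 \<longrightarrow>
       (\<forall>\<mu>0\<in>\<MM>\<^sub>0 X R r. \<forall>\<sigma>2>0.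
          (SUP \<Sigma>\<in>\<CC>. measure (gaussian \<mu>0 (\<sigma>2 *\<^sub>R \<Sigma>)) (W_Het X R r d C)) = 1) \<and>
       size_of_test X R r \<CC> (W_Het X R r d C) = 1)"
proof -
  note X = assms(2) and R = assms(3) and cm = assms(4) and d = assms(5) and het = assms(6)
  have T0: "T_Het X R r d (axis i 1 + \<mu>) = T_Het X R 0 d (axis i 1)" if "\<mu> \<in> \<MM>\<^sub>0 X R r" for i \<mu>
    by (rule T_Het_shift[OF X that])
  show ?thesis
  proof (rule conjI[OF _ conjI]; rule allI; rule impI; elim conjE bexE)
    fix i \<mu>
    assume rk: "rank (B_Het X R (axis i 1)) = CARD('q)"
      and \<mu>: "\<mu> \<in> \<MM>\<^sub>0 X R r" and T: "T_Het X R r d (axis i 1 + \<mu>) > C"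
    have "T_Het X R 0 d (axis i 1) > C" using T T0[OF \<mu>] by simp
    moreover note rejection_prob_tendsto_1[OF X d Omega_Het_nonsingular_of_rank[OF X d rk] tendsto_const this]
    ultimately show "(\<forall>\<mu>\<in>\<MM>\<^sub>0 X R r. T_Het X R r d (axis i 1 + \<mu>) > C) \<and>
       (\<forall>\<mu>0\<in>\<MM>\<^sub>0 X R r. \<forall>\<sigma>2>0.
          (SUP \<Sigma>\<in>\<CC>. measure (gaussian \<mu>0 (\<sigma>2 *\<^sub>R \<Sigma>)) (W_Het X R r d C)) = 1) \<and>
       size_of_test X R r \<CC> (W_Het X R r d C) = 1"
      using null_rejection_SUP_eq_1[OF X R cm het] T0 by simp
  next
    fix i \<mu>
    assume rk: "rank (B_Het X R (axis i 1)) = CARD('q)"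
      and \<mu>: "\<mu> \<in> \<MM>\<^sub>0 X R r" and T: "T_Het X R r d (axis i 1 + \<mu>) < C"
    note nz = Omega_Het_nonsingular_of_rank[OF X d rk]
    have lt: "T_Het X R 0 d (axis i 1) < C" using T T0[OF \<mu>] by simp
    note inf = rejection_INF_eq_0[OF X R d het nz lt, of r]
    have "biased_test X R r \<CC> (W_Het X R r d C)"
      unfolding biased_test_def inf(4) by (rule size_of_test_pos[OF X R d cm het nz])
    then show "(\<forall>\<mu>\<in>\<MM>\<^sub>0 X R r. T_Het X R r d (axis i 1 + \<mu>) < C) \<and>
       (\<forall>\<mu>0\<in>\<MM>\<^sub>0 X R r. \<forall>\<sigma>2>0.
          (INF \<Sigma>\<in>\<CC>. measure (gaussian \<mu>0 (\<sigma>2 *\<^sub>R \<Sigma>)) (W_Het X R r d C)) = 0) \<and>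
       (\<forall>\<sigma>2>0.
          (INF \<mu>1\<in>\<MM>\<^sub>1 X R r. INF \<Sigma>\<in>\<CC>.
             measure (gaussian \<mu>1 (\<sigma>2 *\<^sub>R \<Sigma>)) (W_Het X R r d C)) = 0) \<and>
       biased_test X R r \<CC> (W_Het X R r d C) \<and>
       (\<forall>\<mu>1\<in>\<MM>\<^sub>1 X R r.
          (INF \<sigma>2\<in>{0<..}. INF \<Sigma>\<in>\<CC>.
             measure (gaussian \<mu>1 (\<sigma>2 *\<^sub>R \<Sigma>)) (W_Het X R r d C)) = 0) \<and>
       infimal_power X R r \<CC> (W_Het X R r d C) = 0"
      using inf lt by (intro conjI) (simp_all add: T0)
  next
    fix i
    assume "B_Het X R (axis i 1) = 0" and "R *v beta_hat X (axis i 1) \<noteq> 0"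
    from rejection_prob_tendsto_1_degenerate[OF X d assms(7) this assms(8)]
    show "(\<forall>\<mu>0\<in>\<MM>\<^sub>0 X R r. \<forall>\<sigma>2>0.
          (SUP \<Sigma>\<in>\<CC>. measure (gaussian \<mu>0 (\<sigma>2 *\<^sub>R \<Sigma>)) (W_Het X R r d C)) = 1) \<and>
       size_of_test X R r \<CC> (W_Het X R r d C) = 1"
      by (rule null_rejection_SUP_eq_1[OF X R cm het])
  qed
qed

end
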